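(* Let $m=1$, fix integers $n\ge1$, $k_1,k_2\ge0$ and $C>0$. If $(x,t)\to\infty$ in $\mathbb{R}^{2n}\times\mathbb{R}$ while $0\leq\omega\leq C$, then \[p_{1,k_1,k_2}(x,t)=\frac{1}{|x|}e^{-\frac14 d(x,t)^2}\Psi(\omega)\Big[(-1)^{k_1+k_2}\frac{y_\omega^{n+k_1+k_2}\cos(y_\omega)^{k_1}}{\sin(y_\omega)^{n+k_1}}+O\Big(\frac{1}{|x|^2}\Big)\Big],\] where $\Psi(\omega)=\frac{1}{4^n\pi^{n+1}}\sqrt{\frac{\pi\sin(y_\omega)^3}{\sin(y_\omega)-y_\omega\cos(y_\omega)}}$ if $\omega\neq0$ and $\Psi(0)=\frac{(3\pi)^{1/2}}{4^n\pi^{n+1}}$ (the fraction $\frac{y_\omega^{n+k_1+k_2}\cos(y_\omega)^{k_1}}{\sin(y_\omega)^{n+k_1}}$ being understood by continuity at $y_\omega=0$).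
   Context: For integers $n,m\ge1$, $k_1,k_2\ge0$ and $(x,t)\in\mathbb{R}^{2n}\times\mathbb{R}^m$, with $u_1$ the first standard basis vector of $\mathbb{R}^m$, define \[p_{1,k_1,k_2}(x,t)=\frac{(-1)^{k_1}i^{k_2}}{(4\pi)^n(2\pi)^m}\int_{\mathbb{R}^m}e^{i|t|(\lambda,u_1)-\frac{|x|^2}{4}|\lambda|\coth|\lambda|}\frac{|\lambda|^{n+k_1}\cosh(|\lambda|)^{k_1}}{\sinh(|\lambda|)^{n+k_1}}(\lambda,u_1)^{k_2}\,d\lambda .\] (It is $\partial_R^{k_1}\partial_{|t|}^{k_2}$ of the time-one heat kernel $p_1$ of the H-type group $\mathbb{R}^{2n}\times\mathbb{R}^m$, $p_1$ being regarded as a function of $R=|x|^2/4$ and $|t|$.) Set $R=|x|^2/4$, $\omega=|t|/R$. Let $\theta:(-\pi,\pi)\to\mathbb{R}$, $\theta(\lambda)=\frac{2\lambda-\sin(2\lambda)}{2\sin^2\lambda}$ for $\lambda\ne0$, $\theta(0)=0$; it is an odd increasing analytic diffeomorphism onto $\mathbb{R}$, and $y_\omega=\theta^{-1}(\omega)$. Define $d(x,t)=|x|\,y_\omega/\sin(y_\omega)$ if $x\ne0,t\ne0$; $d(x,0)=|x|$; $d(0,t)=\sqrt{4\pi|t|}$. *)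

theory Defs
  imports "HOL-Analysis.Analysis"
begin

definition hk_theta :: "real \<Rightarrow> real" where
  "hk_theta l = (if l = 0 then 0 else (2 * l - sin (2 * l)) / (2 * (sin l)\<^sup>2))"

definition hk_y :: "real \<Rightarrow> real" where
  "hk_y \<omega> = (THE y. y \<in> {-pi<..<pi} \<and> hk_theta y = \<omega>)"

definition hk_omega :: "real ^ 'd \<Rightarrow> real \<Rightarrow> real" where
  "hk_omega x t = \<bar>t\<bar> / ((norm x)\<^sup>2 / 4)"

definition hk_d :: "real ^ 'd \<Rightarrow> real \<Rightarrow> real" where
  "hk_d x t = (if x \<noteq> 0 \<and> t \<noteq> 0 then norm x * hk_y (hk_omega x t) / sin (hk_y (hk_omega x t))
               else if t = 0 then norm x else sqrt (4 * pi * \<bar>t\<bar>))"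

definition hk_Psi :: "nat \<Rightarrow> real \<Rightarrow> real" where
  "hk_Psi n \<omega> = (if \<omega> \<noteq> 0 then
      1 / (4 ^ n * pi ^ (n + 1)) *
        sqrt (pi * (sin (hk_y \<omega>)) ^ 3 / (sin (hk_y \<omega>) - hk_y \<omega> * cos (hk_y \<omega>)))
    else sqrt (3 * pi) / (4 ^ n * pi ^ (n + 1)))"

text \<open>The fraction y^(n+k1+k2) cos(y)^k1 / sin(y)^(n+k1), extended by continuity at y = 0
  (the limit is 1 if k2 = 0 and 0 otherwise).\<close>
definition hk_frac :: "nat \<Rightarrow> nat \<Rightarrow> nat \<Rightarrow> real \<Rightarrow> real" where
  "hk_frac n k1 k2 y = (if y = 0 then (if k2 = 0 then 1 else 0)
      else y ^ (n + k1 + k2) * (cos y) ^ k1 / (sin y) ^ (n + k1))"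

text \<open>p_{1,k1,k2}(x,t) for m = 1 (so lambda ranges over the reals, (lambda,u_1) = lambda,
  |t| is the absolute value of t), with x in R^{2n} (the dimension of the type 'd is 2n).
  coth is written as cosh/sinh; the single point lambda = 0 is a null set.\<close>
definition hk_p :: "nat \<Rightarrow> nat \<Rightarrow> nat \<Rightarrow> real ^ 'd \<Rightarrow> real \<Rightarrow> complex" where
  "hk_p n k1 k2 x t =
     (-1) ^ k1 * \<i> ^ k2 / complex_of_real ((4 * pi) ^ n * (2 * pi)) *
     integral\<^sup>L lborel (\<lambda>l::real.
        exp (\<i> * complex_of_real (\<bar>t\<bar> * l)
             - complex_of_real ((norm x)\<^sup>2 / 4 * \<bar>l\<bar> * cosh \<bar>l\<bar> / sinh \<bar>l\<bar>)) *
        complex_of_real (\<bar>l\<bar> ^ (n + k1) * (cosh \<bar>l\<bar>) ^ k1 / (sinh \<bar>l\<bar>) ^ (n + k1) * l ^ k2))"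

end

theory Submission
  imports Defs "HOL-Probability.Sinc_Integral" "HOL-Complex_Analysis.Complex_Analysis"
    "HOL-Real_Asymp.Real_Asymp"
begin

text \<open>
  Put \<open>R = |x|\<^sup>2/4\<close>. The integrand \<open>exp (R (i \<omega> z - z coth z)) a(z)\<close> extends holomorphically to the
  strip \<open>|Im z| < \<pi>\<close>, and the exponent has a critical point at \<open>i y\<close> exactly when \<open>\<theta>(y) = \<omega>\<close>.
  Shifting the line of integration to \<open>Im z = y\<close>, the identity
  \<open>Re (z coth z) - y cot y = sinh\<^sup>2 s (s coth s - y cot y) / (sinh\<^sup>2 s + sin\<^sup>2 y)\<close> for \<open>z = s + i y\<close>
  shows that the modulus of the exponential has its maximum at \<open>s = 0\<close>, uniformly for
  \<open>0 \<le> y \<le> y\<^sub>C < \<pi>\<close>. Laplace's method then applies: with the cubic Taylor polynomial of the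
  exponent and the linear one of the amplitude, the terms of relative order \<open>R\<^sup>-\<^sup>1\<^sup>/\<^sup>2\<close> are odd in
  \<open>s\<close> and integrate to zero, which leaves a relative error \<open>O(1/R)\<close>.
\<close>

section \<open>Laplace integrals with uniform error bounds\<close>

text \<open>All constants have to be uniform in the saddle point, which moves with \<omega>. Since
  \<open>hk_y\<close> is monotone, \<omega> \<le> C confines the saddle to a compact segment of the
  imaginary axis strictly below \<i> pi, where Taylor remainders have common bounds. Those bounds
  alone do not suffice: the window |s| \<le> 2 does not shrink with R, so a remainder K s^4 may
  outweigh the quadratic term A s^2 inside it. Hence positivity of the real part comes from the
  explicit identity, and Taylor's formula only measures the error. The leading amplitude can vanish
  (y = pi/2 with k1 > 0, or y = 0 with k2 > 0), so the error is relative to the Gaussian factor and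
  additive beside the amplitude. The exponent at the saddle is -d^2/4, and bounded \<omega> forces
  |x| to infinity because |t| = R \<omega>.\<close>

lemma
  fixes b :: real
  assumes "b > 0"
  shows gaussian_moment_integrable: "integrable lborel (\<lambda>s. exp (- (b * s\<^sup>2)) * s ^ k)"
    and integral_gaussian: "(\<integral>s. exp (- (b * s\<^sup>2)) \<partial>lborel) = sqrt (pi / b)"
    and integral_gaussian_odd: "odd k \<Longrightarrow> (\<integral>s. exp (- (b * s\<^sup>2)) * s ^ k \<partial>lborel) = 0"
proof -
  \<comment> \<open>With this variance the Gaussian is \<open>sqrt (pi / b)\<close> times a centred
    normal density, whose moments are known.\<close>
  define \<sigma> where "\<sigma> = 1 / sqrt (2 * b)"
  have \<sigma>: "\<sigma> > 0" "\<sigma>\<^sup>2 = 1 / (2 * b)"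
    using assms by (simp_all add: \<sigma>_def power_divide)
  have eq: "exp (- (b * s\<^sup>2)) = sqrt (pi / b) * normal_density 0 \<sigma> s" for s
    using assms by (simp add: normal_density_def \<sigma> real_sqrt_divide real_sqrt_mult field_simps)
  show "integrable lborel (\<lambda>s. exp (- (b * s\<^sup>2)) * s ^ k)"
    unfolding eq using integrable_normal_moment[OF \<sigma>(1), of 0 k] by (simp add: mult.assoc)
  show "(\<integral>s. exp (- (b * s\<^sup>2)) \<partial>lborel) = sqrt (pi / b)"
    unfolding eq using \<sigma>(1) by simp
  show "(\<integral>s. exp (- (b * s\<^sup>2)) * s ^ k \<partial>lborel) = 0" if odd: "odd k"
  proof -
    obtain j where j: "k = 2 * j + 1" using odd oddE by blast
    show ?thesis
      unfolding eq j using integral_normal_moment_odd[OF \<sigma>(1), of 0 j] by (simp add: mult.assoc)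
  qed
qed

text \<open>Source of the final rate: 1/(1 + R s^2) has mass pi / sqrt R, so an error dominated by
  L/R times it integrates to O(R^(-3/2)).\<close>

lemma
  fixes r :: real
  assumes "r > 0"
  shows integrable_cauchy_density: "integrable lborel (\<lambda>s. 1 / (1 + r * s\<^sup>2))"
    and integral_cauchy_density: "(\<integral>s. 1 / (1 + r * s\<^sup>2) \<partial>lborel) = pi / sqrt r"
proof -
  have 1: "integrable lborel (\<lambda>s. 1 / (1 + s\<^sup>2 :: real))"
    using integrable_inverse_1_plus_square by (simp add: set_integrable_def inverse_eq_divide)
  have 2: "(\<integral>s. 1 / (1 + s\<^sup>2 :: real) \<partial>lborel) = pi"
    using LBINT_inverse_1_plus_square
    by (simp add: interval_lebesgue_integral_def set_lebesgue_integral_def inverse_eq_divide)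
  have sq: "(sqrt r * s)\<^sup>2 = r * s\<^sup>2" for s using assms by (simp add: power_mult_distrib)
  show "integrable lborel (\<lambda>s. 1 / (1 + r * s\<^sup>2))"
    using lborel_integrable_real_affine[OF 1, of "sqrt r" 0] assms by (simp add: sq)
  show "(\<integral>s. 1 / (1 + r * s\<^sup>2) \<partial>lborel) = pi / sqrt r"
    using lborel_integral_real_affine[of "sqrt r" "\<lambda>s. 1 / (1 + s\<^sup>2 :: real)" 0] assms 2
    by (simp add: sq field_simps)
qed

text \<open>The factor is the maximum of |exp| on the segment from 0 to w. A cruder
  \<open>exp (norm w)\<close> would ruin the later step: with w = -R q it could exceed the Gaussian
  decay, whereas both branches of this maximum stay below it.\<close>

lemma exp_quadratic_remainder:
  "norm (exp w - 1 - w) \<le> (norm w)\<^sup>2 * max 1 (exp (Re w))" for w :: complex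
proof -
  have "norm (exp w - (\<Sum>i\<le>1. exp 0 * (w - 0) ^ i / fact i))
     \<le> max 1 (exp (Re w)) * norm (w - 0) ^ Suc 1 / fact 1"
  proof (rule complex_Taylor[of "closed_segment 0 w" 1 "\<lambda>_. exp"])
    fix x assume "x \<in> closed_segment 0 w"
    then obtain u where u: "0 \<le> u" "u \<le> 1" "x = u *\<^sub>R w" by (auto simp: in_segment)
    have "u * Re w \<le> 0 \<or> u * Re w \<le> Re w"
      using u mult_left_le_one_le[of "Re w" u] mult_nonneg_nonpos[of u "Re w"] by linarith
    then show "norm (exp x) \<le> max 1 (exp (Re w))" by (auto simp: u(3) le_max_iff_disj)
  qed (auto intro!: derivative_eq_intros)
  then show ?thesis by (simp add: diff_diff_eq mult.commute power2_eq_square)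
qed

text \<open>Raising x \<le> exp x at x = c v / m to the m-th power yields the constant
  (m/c)^m.\<close>

lemma power_times_exp_bounded:
  fixes c :: real
  assumes "c > 0"
  shows "\<exists>K\<ge>0. \<forall>v\<ge>0. v ^ m * exp (- (c * v)) \<le> K"
proof (cases "m = 0")
  case True
  then show ?thesis using assms by (intro exI[of _ 1]) auto
next
  case False
  have "v ^ m * exp (- (c * v)) \<le> (real m / c) ^ m" if "v \<ge> 0" for v
  proof -
    have "c * v / m \<le> exp (c * v / m)" using exp_ge_add_one_self[of "c * v / m"] by linarith
    then have "(c * v / m) ^ m \<le> exp (c * v / m) ^ m"
      using that assms by (intro power_mono) auto
    also have "\<dots> = exp (c * v)" using False by (simp flip: exp_of_nat_mult)
    finally have "v ^ m * (c / m) ^ m \<le> exp (c * v)"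
      by (simp add: power_mult_distrib power_divide field_simps)
    then show ?thesis using assms False by (simp add: exp_minus field_simps power_divide)
  qed
  then show ?thesis using assms by (intro exI[of _ "(real m / c) ^ m"]) auto
qed

text \<open>In the variables \<open>w = R s\<^sup>2\<close> (for \<open>|s| \<le> 2\<close>) and \<open>v = R |s|\<close> (for \<open>|s| \<ge> 2\<close>) the difference is a
  polynomial times a decaying exponential, so it has an integrable majorant of total mass
  \<open>O(R\<^sup>-\<^sup>3\<^sup>/\<^sup>2)\<close>.\<close>
lemma laplace_pointwise:
  fixes c K :: real and m :: nat
  assumes "c > 0" "K \<ge> 0"
  shows "\<exists>L\<ge>0. \<forall>h a A B a0 a1 R s.
    R \<ge> 1 \<and> c \<le> A \<and> norm B \<le> K \<and> norm a0 \<le> K \<and> norm a1 \<le> K \<and>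
    (\<bar>s\<bar> \<le> 2 \<longrightarrow> c * s\<^sup>2 \<le> Re h \<and>
       norm (h - of_real (A * s\<^sup>2) - B * of_real s ^ 3) \<le> K * s ^ 4 \<and>
       norm (a - a0 - a1 * of_real s) \<le> K * s\<^sup>2) \<and>
    (\<bar>s\<bar> \<ge> 2 \<longrightarrow> c * \<bar>s\<bar> \<le> Re h \<and> norm a \<le> K * \<bar>s\<bar> ^ m) \<longrightarrow>
    norm (exp (- (of_real R * h)) * a -
          of_real (exp (- (A * R * s\<^sup>2))) * (a0 + a1 * of_real s - of_real R * B * a0 * of_real s ^ 3))
     \<le> L / R * (1 / (1 + R * s\<^sup>2))"
proof -
  have "\<exists>k. \<forall>m. 0 \<le> k m \<and> (\<forall>v\<ge>0. v ^ m * exp (- (c * v)) \<le> k m)"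
    using power_times_exp_bounded[OF assms(1)] by metis
  then obtain k where k: "\<And>m. 0 \<le> k m" "\<And>m v. v \<ge> 0 \<Longrightarrow> v ^ m * exp (- (c * v)) \<le> k m"
    by blast
  \<comment> \<open>Each pair of neighbouring indices comes from the factor 1 + w, respectively v +
    v^2. The numbers come from |a| \<le> 7K, |q| \<le> 3K u^3 and |a - a0| \<le> 3K u below: 10 = 7
    + 3 and 63 = 9 * 7.\<close>
  define L1 where "L1 = K * (k 1 + k 2) + 10 * K\<^sup>2 * (k 2 + k 3) + 63 * K ^ 3 * (k 3 + k 4)"
  define L2 where "L2 = K * (k (m+1) + k (m+2)) + K * (k 1 + k 2) + K * (k 2 + k 3) + K\<^sup>2 * (k 5 + k 6)"
  have L: "L1 \<ge> 0" "L2 \<ge> 0" unfolding L1_def L2_def using k(1) assms(2) by simp_all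
  show ?thesis
  proof (intro exI[of _ "max L1 L2"] conjI allI impI, goal_cases)
    case 1
    then show ?case using L by simp
  next
    case (2 h a A B a0 a1 R s)
    then have R: "R \<ge> 1" and A: "c \<le> A" and B: "norm B \<le> K" and a0: "norm a0 \<le> K"
      and a1: "norm a1 \<le> K" by auto
    let ?s = "complex_of_real s"
    let ?D = "exp (- (of_real R * h)) * a -
          of_real (exp (- (A * R * s\<^sup>2))) * (a0 + a1 * ?s - of_real R * B * a0 * ?s ^ 3)"
    have pos: "1 + R * s\<^sup>2 > 0" using R by (simp add: add_pos_nonneg)
    have Rs: "R * (1 + R * s\<^sup>2) > 0" using R pos by simp
    have expA: "exp (- (A * R * s\<^sup>2)) \<le> exp (- (c * (R * s\<^sup>2)))"
      using A R by (simp add: mult.assoc mult_right_mono)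
    have goal: ?case if "norm ?D * (R * (1 + R * s\<^sup>2)) \<le> L1 \<or> norm ?D * (R * (1 + R * s\<^sup>2)) \<le> L2"
    proof -
      have "norm ?D * (R * (1 + R * s\<^sup>2)) \<le> max L1 L2" using that by linarith
      then have "norm ?D \<le> max L1 L2 / (R * (1 + R * s\<^sup>2))" using Rs by (simp add: pos_le_divide_eq)
      then show ?thesis by simp
    qed
    show ?case
    proof (cases "\<bar>s\<bar> \<le> 2")
      case True
      with 2 have h: "c * s\<^sup>2 \<le> Re h" and q: "norm (h - of_real (A * s\<^sup>2) - B * ?s ^ 3) \<le> K * s ^ 4"
        and b: "norm (a - a0 - a1 * ?s) \<le> K * s\<^sup>2" by auto
      \<comment> \<open>\<open>q\<close> is the exponent without its quadratic term,
        \<open>r\<close> what is left after the cubic term as well, and \<open>e\<close> the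
        second-order remainder of exp(-R q).\<close>
      define q where "q = h - of_real (A * s\<^sup>2)"
      define r where "r = q - B * ?s ^ 3"
      define e where "e = exp (- (of_real R * q)) - 1 + of_real R * q"
      define u where "u = \<bar>s\<bar>"
      define w where "w = R * s\<^sup>2"
      have u: "0 \<le> u" "u \<le> 2" "s\<^sup>2 = u\<^sup>2" "s ^ 4 = u ^ 4" using True by (auto simp: u_def)
      have w: "w \<ge> 0" "w = R * u\<^sup>2" using R by (auto simp: w_def u_def)
      have r: "norm r \<le> K * u ^ 4" using q by (simp add: r_def q_def u)
      have uu: "u ^ 2 \<le> 2 * u" "u ^ 4 \<le> 2 * u ^ 3"
        using u mult_right_mono[of u 2 u] mult_right_mono[of u 2 "u ^ 3"]
        by (auto simp: power2_eq_square numeral_eq_Suc)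
      have nB: "norm (B * ?s ^ 3) \<le> K * u ^ 3"
        using mult_right_mono[OF B, of "u ^ 3"] u by (simp add: norm_mult norm_power u_def)
      have nq: "norm q \<le> 3 * K * u ^ 3"
      proof -
        have "norm q \<le> norm r + norm (B * ?s ^ 3)" unfolding r_def by norm
        also have "\<dots> \<le> K * (2 * u ^ 3) + K * u ^ 3"
          using r nB mult_left_mono[OF uu(2) assms(2)] by linarith
        finally show ?thesis by (simp add: algebra_simps)
      qed
      have naa0: "norm (a - a0) \<le> 3 * K * u"
      proof -
        have "norm (a - a0) \<le> norm (a - a0 - a1 * ?s) + norm (a1 * ?s)" by norm
        also have "\<dots> \<le> K * (2 * u) + K * u"
          using b mult_left_mono[OF uu(1) assms(2)] mult_right_mono[OF a1 u(1)]
          by (simp add: norm_mult u_def)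
        finally show ?thesis by (simp add: algebra_simps)
      qed
      have na: "norm a \<le> 7 * K"
      proof -
        have "norm a \<le> norm a0 + norm (a - a0)" by norm
        also have "\<dots> \<le> K + 3 * K * 2"
          using a0 naa0 mult_left_mono[OF u(2), of "3 * K"] assms(2) by simp
        finally show ?thesis by simp
      qed
      have ne: "exp (- (A * R * s\<^sup>2)) * norm e \<le> R\<^sup>2 * (3 * K * u ^ 3)\<^sup>2 * exp (- (c * w))"
      proof -
        have "norm e \<le> (norm (- (of_real R * q)))\<^sup>2 * max 1 (exp (Re (- (of_real R * q))))"
          using exp_quadratic_remainder[of "- (of_real R * q)"] by (simp add: e_def)
        also have "(norm (- (of_real R * q)))\<^sup>2 = R\<^sup>2 * (norm q)\<^sup>2"
          by (simp add: norm_mult power_mult_distrib)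
        finally have "exp (- (A * R * s\<^sup>2)) * norm e \<le>
            R\<^sup>2 * (norm q)\<^sup>2 * (exp (- (A * R * s\<^sup>2)) * max 1 (exp (Re (- (of_real R * q)))))"
          by (simp add: algebra_simps)
        \<comment> \<open>The branch 1 of the maximum uses A \<ge> c; in the other branch the
          Gaussian recombines with exp(-R q) to exp(-R h), and Re h \<ge> c s^2 applies.\<close>
        also have "exp (- (A * R * s\<^sup>2)) * max 1 (exp (Re (- (of_real R * q)))) \<le> exp (- (c * w))"
        proof -
          have "exp (- (A * R * s\<^sup>2)) * exp (Re (- (of_real R * q))) = exp (- (R * Re h))"
            by (simp add: q_def flip: exp_add) (simp add: algebra_simps)
          also have "\<dots> \<le> exp (- (c * w))"
            using h R mult_left_mono[OF h, of R] by (simp add: w_def algebra_simps)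
          finally show ?thesis using expA by (auto simp: max_def w_def)
        qed
        also have "R\<^sup>2 * (norm q)\<^sup>2 * exp (- (c * w)) \<le> R\<^sup>2 * (3 * K * u ^ 3)\<^sup>2 * exp (- (c * w))"
          using nq by (intro mult_right_mono mult_left_mono power_mono) auto
        finally show ?thesis by (simp add: mult_left_mono)
      qed
      \<comment> \<open>The subtracted polynomial cancels everything of size 1, s and R s^3. What
        survives has size s^2 or R s^4 (in \<open>X\<close>) and R^2 s^6 (in \<open>e * a\<close>),
        each 1/R times a power of w.\<close>
      define X where "X = (a - a0 - a1 * ?s) - of_real R * r * a - of_real R * (B * ?s ^ 3) * (a - a0)"
      have split: "?D = of_real (exp (- (A * R * s\<^sup>2))) * X + of_real (exp (- (A * R * s\<^sup>2))) * e * a"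
      proof -
        have "exp (- (of_real R * h)) = of_real (exp (- (A * R * s\<^sup>2))) * exp (- (of_real R * q))"
          by (simp add: q_def exp_of_real[symmetric] del: exp_of_real flip: exp_add)
            (simp add: algebra_simps)
        moreover have "exp (- (of_real R * q)) = e + 1 - of_real R * q" by (simp add: e_def)
        ultimately show ?thesis unfolding X_def r_def by (simp only:) (simp add: algebra_simps)
      qed
      have nX: "norm X \<le> K * u\<^sup>2 + 10 * K\<^sup>2 * R * u ^ 4"
      proof -
        have 1: "norm (of_real R * r * a) \<le> R * (K * u ^ 4) * (7 * K)"
        proof -
          have "norm (of_real R * r * a) = R * norm r * norm a" using R by (simp add: norm_mult)
          also have "\<dots> \<le> R * (K * u ^ 4) * (7 * K)"
            using r na R assms(2) u by (intro mult_mono) auto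
          finally show ?thesis .
        qed
        have 2: "norm (of_real R * (B * ?s ^ 3) * (a - a0)) \<le> R * (K * u ^ 3) * (3 * K * u)"
        proof -
          have "norm (of_real R * (B * ?s ^ 3) * (a - a0)) = R * norm (B * ?s ^ 3) * norm (a - a0)"
            using R by (simp add: norm_mult)
          also have "\<dots> \<le> R * (K * u ^ 3) * (3 * K * u)"
            using nB naa0 R assms(2) u by (intro mult_mono) auto
          finally show ?thesis .
        qed
        have "norm X \<le> norm (a - a0 - a1 * ?s) + norm (of_real R * r * a)
            + norm (of_real R * (B * ?s ^ 3) * (a - a0))"
          unfolding X_def by norm
        also have "\<dots> \<le> K * u\<^sup>2 + R * (K * u ^ 4) * (7 * K) + R * (K * u ^ 3) * (3 * K * u)"
          using 1 2 b u(3) by (intro add_mono) simp_all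
        also have "\<dots> = K * u\<^sup>2 + 10 * K\<^sup>2 * R * u ^ 4"
          by (simp add: algebra_simps power2_eq_square numeral_eq_Suc)
        finally show ?thesis .
      qed
      have "norm ?D \<le> exp (- (A * R * s\<^sup>2)) * norm X + exp (- (A * R * s\<^sup>2)) * norm e * norm a"
        unfolding split by (rule order.trans[OF norm_triangle_ineq]) (simp add: norm_mult)
      also have "\<dots> \<le> exp (- (c * w)) * (K * u\<^sup>2 + 10 * K\<^sup>2 * R * u ^ 4) +
          R\<^sup>2 * (3 * K * u ^ 3)\<^sup>2 * exp (- (c * w)) * (7 * K)"
        by (intro add_mono mult_mono[OF ne na] mult_mono[OF _ nX]) (use expA in \<open>auto simp: w_def\<close>)
      finally have "norm ?D * (R * (1 + w)) \<le> (exp (- (c * w)) * (K * u\<^sup>2 + 10 * K\<^sup>2 * R * u ^ 4) +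
          R\<^sup>2 * (3 * K * u ^ 3)\<^sup>2 * exp (- (c * w)) * (7 * K)) * (R * (1 + w))"
        using Rs by (intro mult_right_mono) (auto simp: w_def)
      also have "\<dots> = K * (w ^ 1 * exp (- (c * w)) + w ^ 2 * exp (- (c * w)))
         + 10 * K\<^sup>2 * (w ^ 2 * exp (- (c * w)) + w ^ 3 * exp (- (c * w)))
         + 63 * K ^ 3 * (w ^ 3 * exp (- (c * w)) + w ^ 4 * exp (- (c * w)))"
        unfolding w(2) by (simp add: algebra_simps power2_eq_square numeral_eq_Suc)
      also have "\<dots> \<le> L1" unfolding L1_def
        by (intro add_mono mult_left_mono k(2)[OF w(1)]) (use assms(2) in auto)
      finally show ?thesis by (intro goal) (simp add: w_def)
    next
      case False
      with 2 have h: "c * \<bar>s\<bar> \<le> Re h" and a: "norm a \<le> K * \<bar>s\<bar> ^ m" by auto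
      define u where "u = \<bar>s\<bar>"
      define v where "v = R * u"
      have u: "u \<ge> 2" "s\<^sup>2 = u\<^sup>2" using False by (auto simp: u_def)
      have uv: "u \<le> v" "R \<le> v" "0 \<le> v"
        using R u mult_right_mono[of 1 R u] mult_left_mono[of 1 u R] by (auto simp: v_def)
      \<comment> \<open>No cancellation is used away from the saddle: both terms of the difference
        are bounded separately, and s^2 \<ge> |s| lets the Gaussian decay in v too.\<close>
      have expA: "exp (- (A * R * s\<^sup>2)) \<le> exp (- (c * v))"
      proof -
        have "v \<le> R * s\<^sup>2" unfolding v_def u(2) using R u(1) by (simp add: power2_eq_square)
        then have "exp (- (c * (R * s\<^sup>2))) \<le> exp (- (c * v))" using assms(1) by simp
        with expA show ?thesis by linarith
      qed
      have exph: "norm (exp (- (of_real R * h))) \<le> exp (- (c * v))"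
        using R mult_left_mono[OF h, of R] by (simp add: v_def u_def algebra_simps)
      have nP: "norm (a0 + a1 * ?s - of_real R * B * a0 * ?s ^ 3) \<le> K + K * v + K\<^sup>2 * v ^ 4"
      proof -
        have "norm (a0 + a1 * ?s - of_real R * B * a0 * ?s ^ 3)
          \<le> norm a0 + norm (a1 * ?s) + norm (of_real R * B * a0 * ?s ^ 3)" by norm
        also have "\<dots> = norm a0 + norm a1 * u + R * norm B * norm a0 * u ^ 3"
          using R by (simp add: norm_mult norm_power u_def)
        also have "\<dots> \<le> K + K * v + v * K * K * v ^ 3"
          using a0 a1 B uv u(1) assms(2) R by (intro add_mono mult_mono power_mono) auto
        finally show ?thesis by (simp add: power2_eq_square numeral_eq_Suc mult_ac)
      qed
      have "norm ?D \<le> norm (exp (- (of_real R * h)) * a) +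
         norm (of_real (exp (- (A * R * s\<^sup>2))) * (a0 + a1 * ?s - of_real R * B * a0 * ?s ^ 3))" by norm
      also have "\<dots> = norm (exp (- (of_real R * h))) * norm a +
         exp (- (A * R * s\<^sup>2)) * norm (a0 + a1 * ?s - of_real R * B * a0 * ?s ^ 3)"
        by (simp only: norm_mult norm_of_real abs_exp_cancel)
      also have "\<dots> \<le> exp (- (c * v)) * (K * v ^ m) + exp (- (c * v)) * (K + K * v + K\<^sup>2 * v ^ 4)"
      proof (intro add_mono mult_mono exph nP expA)
        have "K * u ^ m \<le> K * v ^ m"
          using uv u(1) assms(2) by (intro mult_left_mono power_mono) auto
        then show "norm a \<le> K * v ^ m" using a by (simp add: u_def)
      qed auto
      finally have "norm ?D * (R * (1 + R * s\<^sup>2)) \<le>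
         (exp (- (c * v)) * (K * v ^ m) + exp (- (c * v)) * (K + K * v + K\<^sup>2 * v ^ 4)) * (v + v\<^sup>2)"
      proof (rule mult_mono)
        have "R * (1 + R * s\<^sup>2) = R + v\<^sup>2"
          unfolding u(2) v_def by (simp add: power2_eq_square algebra_simps)
        then show "R * (1 + R * s\<^sup>2) \<le> v + v\<^sup>2" using uv(2) by simp
        show "0 \<le> exp (- (c * v)) * (K * v ^ m) + exp (- (c * v)) * (K + K * v + K\<^sup>2 * v ^ 4)"
          using assms(2) uv by simp
      qed (use Rs in auto)
      also have "\<dots> = K * (v ^ (m+1) * exp (- (c * v)) + v ^ (m+2) * exp (- (c * v)))
          + K * (v ^ 1 * exp (- (c * v)) + v ^ 2 * exp (- (c * v)))
          + K * (v ^ 2 * exp (- (c * v)) + v ^ 3 * exp (- (c * v)))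
          + K\<^sup>2 * (v ^ 5 * exp (- (c * v)) + v ^ 6 * exp (- (c * v)))"
        by (simp add: algebra_simps power2_eq_square numeral_eq_Suc)
      also have "\<dots> \<le> L2" unfolding L2_def
        by (intro add_mono mult_left_mono k(2)[OF uv(3)]) (use assms(2) in auto)
      finally show ?thesis by (intro goal) simp
    qed
  qed
qed

text \<open>The order of quantifiers is the point: L depends on c, K and m alone, so one constant
  serves a whole family of saddle points. The coefficients B and a1 are absent from the main term
  because they multiply odd Gaussian moments.\<close>

lemma laplace_uniform:
  fixes c K :: real and m :: nat
  assumes "c > 0" "K \<ge> 0"
  shows "\<exists>L\<ge>0. \<forall>(h :: real \<Rightarrow> complex) (a :: real \<Rightarrow> complex) A B a0 a1 R.
    R \<ge> 1 \<and> c \<le> A \<and> norm B \<le> K \<and> norm a0 \<le> K \<and> norm a1 \<le> K \<and>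
    continuous_on UNIV h \<and> continuous_on UNIV a \<and>
    (\<forall>s. \<bar>s\<bar> \<le> 2 \<longrightarrow> c * s\<^sup>2 \<le> Re (h s) \<and>
       norm (h s - of_real (A * s\<^sup>2) - B * of_real s ^ 3) \<le> K * s ^ 4 \<and>
       norm (a s - a0 - a1 * of_real s) \<le> K * s\<^sup>2) \<and>
    (\<forall>s. \<bar>s\<bar> \<ge> 2 \<longrightarrow> c * \<bar>s\<bar> \<le> Re (h s) \<and> norm (a s) \<le> K * \<bar>s\<bar> ^ m) \<longrightarrow>
    integrable lborel (\<lambda>s. exp (- (of_real R * h s)) * a s) \<and>
    norm ((\<integral>s. exp (- (of_real R * h s)) * a s \<partial>lborel) - a0 * of_real (sqrt (pi / (A * R))))
     \<le> L / (R * sqrt R)"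
proof -
  obtain L where L: "L \<ge> 0" and bound: "\<And>h a A B a0 a1 R s.
    R \<ge> 1 \<and> c \<le> A \<and> norm B \<le> K \<and> norm a0 \<le> K \<and> norm a1 \<le> K \<and>
    (\<bar>s\<bar> \<le> 2 \<longrightarrow> c * s\<^sup>2 \<le> Re h \<and>
       norm (h - of_real (A * s\<^sup>2) - B * of_real s ^ 3) \<le> K * s ^ 4 \<and>
       norm (a - a0 - a1 * of_real s) \<le> K * s\<^sup>2) \<and>
    (\<bar>s\<bar> \<ge> 2 \<longrightarrow> c * \<bar>s\<bar> \<le> Re h \<and> norm a \<le> K * \<bar>s\<bar> ^ m) \<Longrightarrow>
    norm (exp (- (of_real R * h)) * a -
          of_real (exp (- (A * R * s\<^sup>2))) * (a0 + a1 * of_real s - of_real R * B * a0 * of_real s ^ 3))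
     \<le> L / R * (1 / (1 + R * s\<^sup>2))"
    using laplace_pointwise[OF assms, of m] by metis
  show ?thesis
  proof (rule exI[of _ "L * pi"], intro conjI[of "0 \<le> L * pi"] allI impI)
    show "0 \<le> L * pi" using L by simp
    fix h a :: "real \<Rightarrow> complex" and A R :: real and B a0 a1 :: complex
    assume asm: "R \<ge> 1 \<and> c \<le> A \<and> norm B \<le> K \<and> norm a0 \<le> K \<and> norm a1 \<le> K \<and>
      continuous_on UNIV h \<and> continuous_on UNIV a \<and>
      (\<forall>s. \<bar>s\<bar> \<le> 2 \<longrightarrow> c * s\<^sup>2 \<le> Re (h s) \<and>
         norm (h s - of_real (A * s\<^sup>2) - B * of_real s ^ 3) \<le> K * s ^ 4 \<and>
         norm (a s - a0 - a1 * of_real s) \<le> K * s\<^sup>2) \<and>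
      (\<forall>s. \<bar>s\<bar> \<ge> 2 \<longrightarrow> c * \<bar>s\<bar> \<le> Re (h s) \<and> norm (a s) \<le> K * \<bar>s\<bar> ^ m)"
    then have R: "R \<ge> 1" and AR: "A * R > 0" and cont: "continuous_on UNIV h" "continuous_on UNIV a"
      using assms(1) by (auto simp: mult_pos_pos)
    define F where "F s = exp (- (of_real R * h s)) * a s" for s
    define g where "g k s = complex_of_real (exp (- (A * R * s\<^sup>2)) * s ^ k)" for k s
    define P where "P s = a0 * g 0 s + a1 * g 1 s - of_real R * B * a0 * g 3 s" for s
    have g: "integrable lborel (g k)" for k
      unfolding g_def using gaussian_moment_integrable[OF AR] by (rule integrable_of_real)
    have Ig: "integral\<^sup>L lborel (g 0) = of_real (sqrt (pi / (A * R)))"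
      "odd k \<Longrightarrow> integral\<^sup>L lborel (g k) = 0" for k
      unfolding g_def integral_complex_of_real
      using integral_gaussian[OF AR] integral_gaussian_odd[OF AR] by simp_all
    have P: "integrable lborel P" unfolding P_def using g by simp
    have IP: "integral\<^sup>L lborel P = a0 * of_real (sqrt (pi / (A * R)))"
      unfolding P_def using g by (simp add: Ig)
    have FP: "norm (F s - P s) \<le> L / R * (1 / (1 + R * s\<^sup>2))" for s
    proof -
      have "F s - P s = exp (- (of_real R * h s)) * a s -
          of_real (exp (- (A * R * s\<^sup>2))) * (a0 + a1 * of_real s - of_real R * B * a0 * of_real s ^ 3)"
        unfolding F_def P_def g_def by (simp add: algebra_simps)
      then show ?thesis using bound[of R A B a0 a1 s "h s" "a s"] asm by simp
    qed
    have dom: "integrable lborel (\<lambda>s. L / R * (1 / (1 + R * s\<^sup>2)))"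
      using R by (intro integrable_mult_right integrable_cauchy_density) auto
    have "continuous_on UNIV F" unfolding F_def by (intro continuous_intros cont)
    then have "F \<in> borel_measurable lborel"
      by (simp add: borel_measurable_continuous_onI)
    moreover have "norm (F s - P s) \<le> norm (L / R * (1 / (1 + R * s\<^sup>2)))" for s
      using FP[of s] by (metis abs_ge_self order.trans real_norm_def)
    ultimately have D: "integrable lborel (\<lambda>s. F s - P s)"
      using P by (intro Bochner_Integration.integrable_bound[OF dom]) auto
    then have F: "integrable lborel F" using Bochner_Integration.integrable_add[OF D P] by simp
    have "norm (integral\<^sup>L lborel F - integral\<^sup>L lborel P) = norm (\<integral>s. F s - P s \<partial>lborel)"
      using F P by simp
    also have "\<dots> \<le> (\<integral>s. L / R * (1 / (1 + R * s\<^sup>2)) \<partial>lborel)"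
      using FP by (rule Bochner_Integration.integral_norm_bound_integral[OF D dom])
    also have "\<dots> = L * pi / (R * sqrt R)"
      unfolding integral_mult_right_zero using integral_cauchy_density[of R] R by simp
    finally show "integrable lborel (\<lambda>s. exp (- (of_real R * h s)) * a s) \<and>
      norm ((\<integral>s. exp (- (of_real R * h s)) * a s \<partial>lborel) - a0 * of_real (sqrt (pi / (A * R))))
     \<le> L * pi / (R * sqrt R)"
      using F unfolding IP unfolding F_def by simp
  qed
qed

section \<open>The function \<open>z coth z\<close> on the strip\<close>

text \<open>The value at 0 removes the singularity, so that every function built from it is
  holomorphic on the whole strip, whose edges carry the nearest zeros \<i> pi and -\<i> pi.\<close>

definition sinhc :: "complex \<Rightarrow> complex" where
  "sinhc z = (if z = 0 then 1 else sinh z / z)"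

definition zcoth :: "complex \<Rightarrow> complex" where
  "zcoth z = cosh z / sinhc z"

definition ycot :: "real \<Rightarrow> real" where
  "ycot y = (if y = 0 then 1 else y * cos y / sin y)"

definition strip :: "complex set" where
  "strip = {z. \<bar>Im z\<bar> < pi}"

lemma open_strip: "open strip"
proof -
  have eq: "strip = {z. - pi < Im z} \<inter> {z. Im z < pi}" by (auto simp: strip_def)
  show ?thesis unfolding eq by (intro open_Int open_halfspace_Im_gt open_halfspace_Im_lt)
qed

lemma convex_strip: "convex strip"
proof -
  have eq: "strip = {z. - pi < Im z} \<inter> {z. Im z < pi}" by (auto simp: strip_def)
  show ?thesis unfolding eq by (intro convex_Int convex_halfspace_Im_gt convex_halfspace_Im_lt)
qed

lemma complex_sinh_cosh:
  "Re (sinh z) = sinh (Re z) * cos (Im z)" "Im (sinh z) = cosh (Re z) * sin (Im z)"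
  "Re (cosh z) = cosh (Re z) * cos (Im z)" "Im (cosh z) = sinh (Re z) * sin (Im z)"
  by (simp_all add: sinh_field_def cosh_field_def Re_exp Im_exp field_simps)

lemma norm_sinh_squared: "(norm (sinh z))\<^sup>2 = (sinh (Re z))\<^sup>2 + (sin (Im z))\<^sup>2"
proof -
  have "(norm (sinh z))\<^sup>2 = (sinh (Re z))\<^sup>2 * (cos (Im z))\<^sup>2 + (1 + (sinh (Re z))\<^sup>2) * (sin (Im z))\<^sup>2"
    by (simp add: cmod_power2 complex_sinh_cosh power_mult_distrib cosh_square_eq)
  also have "\<dots> = (sinh (Re z))\<^sup>2 * ((cos (Im z))\<^sup>2 + (sin (Im z))\<^sup>2) + (sin (Im z))\<^sup>2"
    by algebra
  finally show ?thesis by simp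
qed

lemma norm_cosh_le: "norm (cosh z) \<le> cosh (Re z)" for z :: complex
proof -
  have "(norm (cosh z))\<^sup>2 = (cosh (Re z))\<^sup>2 * (cos (Im z))\<^sup>2 + ((cosh (Re z))\<^sup>2 - 1) * (sin (Im z))\<^sup>2"
    by (simp add: cmod_power2 complex_sinh_cosh power_mult_distrib cosh_square_eq)
  also have "\<dots> = (cosh (Re z))\<^sup>2 * ((cos (Im z))\<^sup>2 + (sin (Im z))\<^sup>2) - (sin (Im z))\<^sup>2"
    by algebra
  also have "\<dots> \<le> (cosh (Re z))\<^sup>2" by simp
  finally show ?thesis by (rule power2_le_imp_le) (simp add: cosh_real_nonneg)
qed

lemma sin_nonzero_strip: "\<bar>y\<bar> < pi \<Longrightarrow> y \<noteq> 0 \<Longrightarrow> sin y \<noteq> 0" for y :: real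
  using sin_gt_zero[of y] sin_gt_zero[of "-y"] by (cases "y > 0") auto

lemma sinh_nonzero_strip:
  assumes "z \<in> strip" "z \<noteq> 0"
  shows "sinh z \<noteq> 0"
proof
  assume "sinh z = 0"
  with norm_sinh_squared[of z] have "sinh (Re z) = 0" "sin (Im z) = 0"
    by (auto simp: sum_power2_eq_zero_iff)
  then show False using assms sin_nonzero_strip[of "Im z"] by (auto simp: strip_def complex_eq_iff)
qed

lemma sinhc_nonzero: "z \<in> strip \<Longrightarrow> sinhc z \<noteq> 0"
  using sinh_nonzero_strip by (auto simp: sinhc_def)

lemma holomorphic_on_sinhc: "sinhc holomorphic_on S"
proof -
  have "(sinh has_field_derivative (1::complex)) (at 0)" by (auto intro!: derivative_eq_intros)
  then have "deriv sinh (0::complex) = 1" by (rule DERIV_imp_deriv)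
  moreover have "sinh holomorphic_on (UNIV :: complex set)"
    unfolding sinh_field_def by (intro holomorphic_intros) auto
  ultimately have "sinhc holomorphic_on UNIV"
    by (intro pole_theorem_open_0[of sinh UNIV 0 sinhc]) (auto simp: sinhc_def)
  then show ?thesis by (rule holomorphic_on_subset) auto
qed

lemma holomorphic_on_zcoth: "zcoth holomorphic_on strip"
proof -
  have "cosh holomorphic_on strip"
    unfolding cosh_field_def by (intro holomorphic_intros) auto
  then show ?thesis
    unfolding zcoth_def[abs_def]
    by (intro holomorphic_intros holomorphic_on_sinhc sinhc_nonzero)
qed

lemma zcoth_nonzero_eq: "z \<noteq> 0 \<Longrightarrow> zcoth z = z * cosh z / sinh z"
  by (simp add: zcoth_def sinhc_def)

lemma zcoth_0 [simp]: "zcoth 0 = 1"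
  by (simp add: zcoth_def sinhc_def)

lemma sinh_imaginary: "sinh (\<i> * of_real y) = \<i> * of_real (sin y)"
  and cosh_imaginary: "cosh (\<i> * of_real y) = of_real (cos y)"
  by (simp_all add: complex_eq_iff complex_sinh_cosh)

lemma zcoth_imaginary: "zcoth (\<i> * of_real y) = of_real (ycot y)"
  by (simp add: zcoth_def sinhc_def ycot_def sinh_imaginary cosh_imaginary)

text \<open>Expanding with \<open>cnj (sinh z)\<close> shows that the real part is the weighted mean
  of s coth s and y cot y with weights sinh^2 s and sin^2 y. The form stated isolates its excess
  over the value at s = 0.\<close>

lemma Re_zcoth:
  assumes "\<bar>y\<bar> < pi" "s \<noteq> 0"
  shows "Re (zcoth (Complex s y)) =
    ycot y + (sinh s)\<^sup>2 * (s * cosh s / sinh s - ycot y) / ((sinh s)\<^sup>2 + (sin y)\<^sup>2)"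
proof -
  let ?z = "Complex s y"
  have z: "?z \<noteq> 0" "sinh s \<noteq> 0" using assms by (auto simp: complex_eq_iff)
  have D: "(sinh s)\<^sup>2 + (sin y)\<^sup>2 > 0" using z by (simp add: add_pos_nonneg)
  have "Re (zcoth ?z) = Re (?z * cosh ?z * cnj (sinh ?z)) / (norm (sinh ?z))\<^sup>2"
    unfolding zcoth_nonzero_eq[OF z(1)] by (subst complex_div_cnj) (simp add: Re_divide_of_real)
  also have "Re (?z * cosh ?z * cnj (sinh ?z)) =
     s * sinh s * cosh s * ((cos y)\<^sup>2 + (sin y)\<^sup>2) + y * sin y * cos y * ((cosh s)\<^sup>2 - (sinh s)\<^sup>2)"
    by (simp add: complex_sinh_cosh algebra_simps power2_eq_square
        del: sin_cos_squared_add sin_cos_squared_add2 sin_cos_squared_add3)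
  also have "\<dots> = s * sinh s * cosh s + y * sin y * cos y" by (simp add: cosh_square_eq)
  also have "y * sin y * cos y = ycot y * (sin y)\<^sup>2"
    using sin_nonzero_strip[OF assms(1)] by (simp add: ycot_def power2_eq_square)
  finally have "Re (zcoth ?z) = (s * sinh s * cosh s + ycot y * (sin y)\<^sup>2) / ((sinh s)\<^sup>2 + (sin y)\<^sup>2)"
    by (simp add: norm_sinh_squared)
  moreover have "(sinh s)\<^sup>2 * (s * cosh s / sinh s - ycot y) = s * sinh s * cosh s - ycot y * (sinh s)\<^sup>2"
    using z by (simp add: field_simps power2_eq_square)
  ultimately show ?thesis using D D[THEN less_imp_neq, symmetric] by (simp add: field_simps)
qed

section \<open>Coercivity of the real part of z coth z on horizontal lines\<close>

lemma cosh_minus_sinh_ge: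
  fixes s :: real
  assumes "s \<ge> 0"
  shows "s * cosh s - sinh s \<ge> s ^ 3 / 3"
proof -
  have "(\<lambda>s. s * cosh s - sinh s - s ^ 3 / 3) 0 \<le> (\<lambda>s. s * cosh s - sinh s - s ^ 3 / 3) s"
  proof (rule DERIV_nonneg_imp_nondecreasing[OF assms])
    fix x :: real assume x: "0 \<le> x" "x \<le> s"
    have "((\<lambda>s. s * cosh s - sinh s - s ^ 3 / 3) has_real_derivative (x * (sinh x - x))) (at x)"
      by (auto intro!: derivative_eq_intros simp: algebra_simps power2_eq_square)
    moreover have "x * (sinh x - x) \<ge> 0" using x real_le_x_sinh[of x] by (simp add: sinh_field_def exp_minus)
    ultimately show "\<exists>y. ((\<lambda>s. s * cosh s - sinh s - s ^ 3 / 3) has_real_derivative y) (at x) \<and> y \<ge> 0"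
      by blast
  qed
  then show ?thesis by simp
qed

lemma x_le_sinh: "x \<ge> 0 \<Longrightarrow> x \<le> sinh x" for x :: real
  using real_le_x_sinh[of x] by (simp add: sinh_field_def exp_minus)

text \<open>s coth s - 1 is at least s^3 / (3 sinh s), and sinh s \<le> s cosh s \<le> s cosh 2 for
  0 < s \<le> 2; this is the origin of the constant 3 cosh 2.\<close>

lemma xcoth_ge_small:
  fixes s :: real
  assumes "s \<noteq> 0" "\<bar>s\<bar> \<le> 2"
  shows "s * cosh s / sinh s \<ge> 1 + s\<^sup>2 / (3 * cosh 2)"
proof -
  have *: "s * cosh s / sinh s \<ge> 1 + s\<^sup>2 / (3 * cosh 2)" if s: "s > 0" "s \<le> 2" for s :: real
  proof -
    have "sinh s \<le> s * cosh s" using cosh_minus_sinh_ge[of s] s by (smt (verit) zero_le_power divide_nonneg_pos)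
    also have "\<dots> \<le> s * cosh 2" using s by (simp add: cosh_real_nonneg_le_iff)
    finally have "s\<^sup>2 * sinh s \<le> s\<^sup>2 * (s * cosh 2)" by (rule mult_left_mono) simp
    then have "s\<^sup>2 * sinh s / (3 * cosh 2) \<le> s ^ 3 / 3"
      by (simp add: field_simps power2_eq_square numeral_eq_Suc)
    also have "\<dots> \<le> s * cosh s - sinh s" using cosh_minus_sinh_ge[of s] s by simp
    finally show ?thesis using s by (simp add: field_simps)
  qed
  show ?thesis using *[of s] *[of "-s"] assms by (cases "s > 0") auto
qed

text \<open>Here coth s \<ge> 1 is enough, since 1 + s/2 \<le> s exactly for s \<ge> 2. This fixes
  the cut-off 2 used throughout.\<close>

lemma xcoth_ge_large:
  fixes s :: real
  assumes "\<bar>s\<bar> \<ge> 2"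
  shows "s * cosh s / sinh s \<ge> 1 + \<bar>s\<bar> / 2"
proof -
  have *: "s * cosh s / sinh s \<ge> 1 + s / 2" if s: "s \<ge> 2" for s :: real
  proof -
    have "(1 + s / 2) * sinh s \<le> s * cosh s" using s sinh_le_cosh_real[of s] by (intro mult_mono) auto
    then show ?thesis using s by (simp add: field_simps)
  qed
  show ?thesis using *[of s] *[of "-s"] assms by (cases "s > 0") auto
qed

text \<open>Two monotonicity arguments are nested: the difference of the two sides has derivative
  t/3 (sin t - t cos t), and sin t - t cos t itself has derivative t sin t. Both sides behave like
  y^3/3 at 0. The inequality yields the upper bound for y cot y and the lower bound for
  \<open>acoef\<close>.\<close>

lemma sin_minus_cos_ge:
  assumes "0 \<le> y" "y \<le> pi"
  shows "sin y - y * cos y \<ge> y\<^sup>2 * sin y / 3"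
proof -
  have pos: "sin x - x * cos x \<ge> 0" if "0 \<le> x" "x \<le> pi" for x
  proof -
    have "(\<lambda>x. sin x - x * cos x) 0 \<le> (\<lambda>x. sin x - x * cos x) x"
    proof (rule DERIV_nonneg_imp_nondecreasing[OF that(1)])
      fix t assume t: "0 \<le> t" "t \<le> x"
      have "((\<lambda>x. sin x - x * cos x) has_real_derivative t * sin t) (at t)"
        by (auto intro!: derivative_eq_intros)
      moreover have "t * sin t \<ge> 0" using t that by (simp add: sin_ge_zero)
      ultimately show "\<exists>y. ((\<lambda>x. sin x - x * cos x) has_real_derivative y) (at t) \<and> y \<ge> 0" by blast
    qed
    then show ?thesis by simp
  qed
  let ?f = "\<lambda>x. sin x - x * cos x - x\<^sup>2 * sin x / 3"
  have "?f 0 \<le> ?f y"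
  proof (rule DERIV_nonneg_imp_nondecreasing[OF assms(1)])
    fix t assume t: "0 \<le> t" "t \<le> y"
    have "(?f has_real_derivative t / 3 * (sin t - t * cos t)) (at t)"
      by (auto intro!: derivative_eq_intros simp: field_simps power2_eq_square)
    moreover have "t / 3 * (sin t - t * cos t) \<ge> 0" using t assms pos by simp
    ultimately show "\<exists>y. (?f has_real_derivative y) (at t) \<and> y \<ge> 0" by blast
  qed
  then show ?thesis by simp
qed

lemma ycot_le:
  assumes "0 \<le> y" "y < pi"
  shows "ycot y \<le> 1 - y\<^sup>2 / 3"
proof (cases "y = 0")
  case False
  then have "sin y > 0" using assms by (simp add: sin_gt_zero)
  then show ?thesis using sin_minus_cos_ge[of y] assms False by (simp add: ycot_def field_simps)
qed (simp add: ycot_def)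

text \<open>The weight sinh^2 s / (sinh^2 s + sin^2 y) is itself quadratically small near s = 0 when
  y > 0, so s coth s \<ge> 1 + c s^2 with y cot y \<le> 1 would give only a quartic bound. The extra
  y^2/3 in 1 - y cot y compensates: s^2 sin^2 y \<le> y^2 sinh^2 s turns c (s^2 + y^2) into c s^2
  uniformly in y. For |s| \<ge> 2 the weight is at least 1/2, which reduces |s|/2 to |s|/4.\<close>

lemma Re_zcoth_ge:
  assumes y: "0 \<le> y" "y < pi"
  shows "\<bar>s\<bar> \<le> 2 \<Longrightarrow> ycot y + s\<^sup>2 / (3 * cosh 2) \<le> Re (zcoth (Complex s y))"
    and "\<bar>s\<bar> \<ge> 2 \<Longrightarrow> ycot y + \<bar>s\<bar> / 4 \<le> Re (zcoth (Complex s y))"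
proof -
  have ch: "cosh (2::real) \<ge> 1" by (rule cosh_real_ge_1)
  have sh: "(sinh s)\<^sup>2 \<ge> s\<^sup>2" for s :: real
    using x_le_sinh[of "\<bar>s\<bar>"] by (metis abs_ge_zero abs_le_square_iff abs_of_nonneg order_trans sinh_real_abs power2_abs)
  have sy: "(sin y)\<^sup>2 \<le> y\<^sup>2" using abs_sin_x_le_abs_x[of y] by (simp add: abs_le_square_iff)
  show "ycot y + s\<^sup>2 / (3 * cosh 2) \<le> Re (zcoth (Complex s y))" if s: "\<bar>s\<bar> \<le> 2"
  proof (cases "s = 0")
    case True
    then have "Complex s y = \<i> * of_real y" by (simp add: complex_eq_iff)
    then show ?thesis using True by (simp add: zcoth_imaginary)
  next
    case False
    define X where "X = s * cosh s / sinh s - ycot y"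
    define c :: real where "c = 1 / (3 * cosh 2)"
    have c: "c \<ge> 0" "c \<le> 1 / 3" using ch by (auto simp: c_def field_simps)
    have "c * y\<^sup>2 \<le> 1 / 3 * y\<^sup>2" using c(2) by (rule mult_right_mono) simp
    then have X: "X \<ge> c * (s\<^sup>2 + y\<^sup>2)"
      using xcoth_ge_small[OF False s] ycot_le[OF y] by (simp add: X_def c_def algebra_simps)
    have D: "(sinh s)\<^sup>2 + (sin y)\<^sup>2 > 0" using False by (simp add: add_pos_nonneg)
    have "s\<^sup>2 * (sin y)\<^sup>2 \<le> (sinh s)\<^sup>2 * y\<^sup>2" using sh sy by (intro mult_mono) auto
    then have "c * (s\<^sup>2 * ((sinh s)\<^sup>2 + (sin y)\<^sup>2)) \<le> c * ((sinh s)\<^sup>2 * (s\<^sup>2 + y\<^sup>2))"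
      using c by (intro mult_left_mono) (simp_all add: algebra_simps)
    also have "\<dots> \<le> (sinh s)\<^sup>2 * X" using X mult_left_mono[OF X, of "(sinh s)\<^sup>2"] by (simp add: algebra_simps)
    finally have "c * s\<^sup>2 \<le> (sinh s)\<^sup>2 * X / ((sinh s)\<^sup>2 + (sin y)\<^sup>2)" using D by (simp add: field_simps)
    then show ?thesis using Re_zcoth[of y s] y False by (simp add: X_def c_def)
  qed
  show "ycot y + \<bar>s\<bar> / 4 \<le> Re (zcoth (Complex s y))" if s: "\<bar>s\<bar> \<ge> 2"
  proof -
    define X where "X = s * cosh s / sinh s - ycot y"
    have "ycot y \<le> 1" using ycot_le[OF y] by (smt (verit) zero_le_power2 divide_nonneg_pos)
    then have X: "X \<ge> \<bar>s\<bar> / 2" unfolding X_def using xcoth_ge_large[OF s] by linarith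
    have "s\<^sup>2 \<ge> 1" using s by (simp add: abs_square_less_1 flip: not_less)
    then have sn: "(sin y)\<^sup>2 \<le> (sinh s)\<^sup>2" "(sinh s)\<^sup>2 > 0"
      using sh[of s] abs_square_le_1[of "sin y"] by auto
    then have D: "(sinh s)\<^sup>2 + (sin y)\<^sup>2 > 0" by (simp add: add_pos_nonneg)
    have "\<bar>s\<bar> / 4 * ((sinh s)\<^sup>2 + (sin y)\<^sup>2) \<le> \<bar>s\<bar> / 4 * (2 * (sinh s)\<^sup>2)"
      using sn by (intro mult_left_mono) auto
    also have "\<dots> \<le> (sinh s)\<^sup>2 * X" using mult_left_mono[OF X, of "(sinh s)\<^sup>2"] by (simp add: algebra_simps)
    finally have "\<bar>s\<bar> / 4 \<le> (sinh s)\<^sup>2 * X / ((sinh s)\<^sup>2 + (sin y)\<^sup>2)" using D by (simp add: field_simps)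
    then show ?thesis using Re_zcoth[of y s] y s by (auto simp: X_def)
  qed
qed

section \<open>Uniform Taylor expansion and derivatives on the imaginary axis\<close>

lemma holomorphic_uniform_taylor:
  assumes "f holomorphic_on U" "open U" "compact S" "convex S" "S \<subseteq> U"
  shows "\<exists>K\<ge>0. (\<forall>k\<le>Suc n. \<forall>z\<in>S. norm ((deriv ^^ k) f z) \<le> K) \<and>
    (\<forall>w\<in>S. \<forall>z\<in>S. norm (f z - (\<Sum>i\<le>n. (deriv ^^ i) f w * (z - w) ^ i / fact i)) \<le> K * norm (z - w) ^ Suc n)"
proof -
  have hol: "(deriv ^^ k) f holomorphic_on U" for k
    using assms by (intro holomorphic_higher_deriv)
  have "\<exists>B. \<forall>z\<in>S. norm ((deriv ^^ k) f z) \<le> B" for k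
  proof -
    have "continuous_on S ((deriv ^^ k) f)"
      using hol assms by (meson holomorphic_on_imp_continuous_on continuous_on_subset)
    then have "bounded ((deriv ^^ k) f ` S)"
      using assms(3) by (intro compact_imp_bounded compact_continuous_image)
    then show ?thesis by (auto simp: bounded_iff)
  qed
  then obtain B where B: "\<And>k z. z \<in> S \<Longrightarrow> norm ((deriv ^^ k) f z) \<le> B k" by metis
  define K where "K = (\<Sum>k\<le>Suc n. \<bar>B k\<bar>)"
  have K0: "K \<ge> 0" unfolding K_def by (intro sum_nonneg) auto
  have K: "norm ((deriv ^^ k) f z) \<le> K" if "k \<le> Suc n" "z \<in> S" for k z
  proof -
    have "\<bar>B k\<bar> \<le> K" unfolding K_def using that(1) by (intro member_le_sum) auto
    then show ?thesis using B[OF that(2), of k] by linarith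
  qed
  have "norm (f z - (\<Sum>i\<le>n. (deriv ^^ i) f w * (z - w) ^ i / fact i)) \<le> K * norm (z - w) ^ Suc n"
    if "w \<in> S" "z \<in> S" for w z
  proof -
    have "norm ((deriv ^^ 0) f z - (\<Sum>i\<le>n. (deriv ^^ i) f w * (z - w) ^ i / fact i))
        \<le> K * norm (z - w) ^ Suc n / fact n"
    proof (rule complex_Taylor[OF assms(4) _ _ that])
      fix i x assume "x \<in> S" "i \<le> n"
      then show "((deriv ^^ i) f has_field_derivative (deriv ^^ Suc i) f x) (at x within S)"
        using holomorphic_derivI[OF hol assms(2), of x i] assms(5)
        by (auto intro: has_field_derivative_at_within)
    next
      show "norm ((deriv ^^ Suc n) f x) \<le> K" if "x \<in> S" for x
        using that by (rule K[OF order_refl])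
    qed
    also have "\<dots> \<le> K * norm (z - w) ^ Suc n / 1"
      using K0 by (intro divide_left_mono) (auto simp: fact_ge_1)
    finally show ?thesis by simp
  qed
  then show ?thesis using K K0 by blast
qed

text \<open>Half the second derivative of \<open>zcoth\<close> at \<open>\<i> * y\<close>.\<close>
definition acoef :: "real \<Rightarrow> real" where
  "acoef y = (if y = 0 then 1 / 3 else (sin y - y * cos y) / sin y ^ 3)"

lemma open_strip_minus_0: "open (strip - {0})"
  by (simp add: open_strip open_delete)

lemma zcoth_DERIV:
  assumes "z \<in> strip - {0}"
  shows "deriv zcoth z = cosh z / sinh z - z / (sinh z)\<^sup>2"
    and "(deriv ^^ 2) zcoth z = 2 * (z * cosh z - sinh z) / sinh z ^ 3"
proof -
  have 1: "deriv zcoth z = cosh z / sinh z - z / (sinh z)\<^sup>2" if z: "z \<in> strip - {0}" for z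
  proof (rule DERIV_imp_deriv)
    have "((\<lambda>z. z * cosh z / sinh z) has_field_derivative cosh z / sinh z - z / (sinh z)\<^sup>2) (at z)"
      using sinh_nonzero_strip[of z] z
      by (auto intro!: derivative_eq_intros simp: field_simps power2_eq_square
          cosh_square_eq[unfolded power2_eq_square])
    then show "(zcoth has_field_derivative cosh z / sinh z - z / (sinh z)\<^sup>2) (at z)"
      by (rule has_field_derivative_transform_within_open[OF _ open_strip_minus_0 z])
        (simp add: zcoth_nonzero_eq)
  qed
  then show "deriv zcoth z = cosh z / sinh z - z / (sinh z)\<^sup>2" using assms .
  have nz: "sinh z \<noteq> 0" using sinh_nonzero_strip[of z] assms by simp
  have "(sinh z * sinh z - cosh z * cosh z) / (sinh z * sinh z) = - 1 / (sinh z)\<^sup>2"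
    using cosh_square_eq[of z] by (simp add: power2_eq_square)
  moreover have *: "- 1 / s\<^sup>2 - (s\<^sup>2 - z * (2 * s * c)) / (s\<^sup>2 * s\<^sup>2) = 2 * (z * c - s) / s ^ 3"
    if "s \<noteq> 0" for s c :: complex
    using that by (simp add: field_simps) (simp add: algebra_simps eval_nat_numeral)
  ultimately have eq: "(sinh z * sinh z - cosh z * cosh z) / (sinh z * sinh z) -
      ((sinh z)\<^sup>2 - z * (2 * sinh z * cosh z)) / ((sinh z)\<^sup>2 * (sinh z)\<^sup>2) = 2 * (z * cosh z - sinh z) / sinh z ^ 3"
    using * nz by simp
  have "((\<lambda>z. cosh z / sinh z - z / (sinh z)\<^sup>2) has_field_derivative
      2 * (z * cosh z - sinh z) / sinh z ^ 3) (at z)"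
    unfolding eq[symmetric] using nz by (auto intro!: derivative_eq_intros)
  then have "(deriv zcoth has_field_derivative 2 * (z * cosh z - sinh z) / sinh z ^ 3) (at z)"
    by (rule has_field_derivative_transform_within_open[OF _ open_strip_minus_0 assms]) (simp add: 1)
  then show "(deriv ^^ 2) zcoth z = 2 * (z * cosh z - sinh z) / sinh z ^ 3"
    by (simp add: numeral_2_eq_2 DERIV_imp_deriv)
qed

lemma imaginary_in_strip: "\<i> * of_real y \<in> strip \<longleftrightarrow> \<bar>y\<bar> < pi"
  by (simp add: strip_def)

text \<open>The closed forms of the derivatives divide by sinh z and fail at 0. Derivatives of a
  holomorphic function are continuous, so their values at 0 reduce to one-sided real limits along
  the imaginary axis.\<close>

lemma higher_deriv_at_0_limit:
  assumes "((\<lambda>y. (deriv ^^ k) zcoth (\<i> * of_real y)) \<longlongrightarrow> l) (at_right 0)"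
  shows "(deriv ^^ k) zcoth 0 = l"
proof -
  have "(deriv ^^ k) zcoth holomorphic_on strip"
    by (intro holomorphic_higher_deriv holomorphic_on_zcoth open_strip)
  then have "isCont ((deriv ^^ k) zcoth) 0"
    using open_strip by (intro continuous_on_interior[of strip] holomorphic_on_imp_continuous_on)
      (auto simp: interior_open strip_def)
  moreover have "((\<lambda>y::real. \<i> * of_real y) \<longlongrightarrow> \<i> * of_real 0) (at_right 0)"
    by (intro tendsto_intros)
  ultimately have "((\<lambda>y. (deriv ^^ k) zcoth (\<i> * of_real y)) \<longlongrightarrow> (deriv ^^ k) zcoth 0) (at_right 0)"
    by (auto intro: isCont_tendsto_compose)
  then show ?thesis using assms by (metis tendsto_unique trivial_limit_at_right_real)
qed

text \<open>The critical-point equation in explicit form: the derivative of \<i> \<omega> z - z coth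
  z at \<i> y is \<i> (\<omega> - theta(y)).\<close>

lemma zcoth_deriv_imaginary:
  assumes "\<bar>y\<bar> < pi"
  shows "deriv zcoth (\<i> * of_real y) = \<i> * of_real (hk_theta y)"
proof -
  have *: "deriv zcoth (\<i> * of_real y) = \<i> * of_real (hk_theta y)" if y: "y \<noteq> 0" "\<bar>y\<bar> < pi" for y
  proof -
    have "c / (\<i> * s) - \<i> * x / (\<i> * s)\<^sup>2 = \<i> * ((2 * x - 2 * s * c) / (2 * s\<^sup>2))" if "s \<noteq> 0" for c s x :: complex
      using that by (simp add: field_simps power2_eq_square)
    from this[of "of_real (sin y)" "of_real (cos y)" "of_real y"] show ?thesis
      using zcoth_DERIV(1)[of "\<i> * of_real y"] sin_nonzero_strip[OF y(2,1)] y
      by (simp add: imaginary_in_strip sinh_imaginary cosh_imaginary hk_theta_def sin_double)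
  qed
  have "((\<lambda>y. (deriv ^^ 1) zcoth (\<i> * of_real y)) \<longlongrightarrow> 0) (at_right 0)"
  proof (rule Lim_transform_eventually)
    have "((\<lambda>y::real. (2 * y - sin (2 * y)) / (2 * (sin y)\<^sup>2)) \<longlongrightarrow> 0) (at_right 0)" by real_asymp
    from tendsto_mult[OF tendsto_const[of \<i>] tendsto_of_real[OF this]]
    show "((\<lambda>y::real. \<i> * of_real ((2 * y - sin (2 * y)) / (2 * (sin y)\<^sup>2))) \<longlongrightarrow> 0) (at_right 0)" by simp
    have "eventually (\<lambda>y. y \<in> {0<..<pi}) (at_right (0::real))"
      by (intro eventually_at_right_real pi_gt_zero)
    then show "\<forall>\<^sub>F y in at_right 0. \<i> * of_real ((2 * y - sin (2 * y)) / (2 * (sin y)\<^sup>2)) = (deriv ^^ 1) zcoth (\<i> * of_real y)"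
      by eventually_elim (simp add: * hk_theta_def)
  qed
  then show ?thesis using * assms higher_deriv_at_0_limit[of 1 0] by (cases "y = 0") (auto simp: hk_theta_def)
qed

lemma zcoth_deriv2_imaginary:
  assumes "\<bar>y\<bar> < pi"
  shows "(deriv ^^ 2) zcoth (\<i> * of_real y) = of_real (2 * acoef y)"
proof -
  have *: "(deriv ^^ 2) zcoth (\<i> * of_real y) = of_real (2 * acoef y)" if y: "y \<noteq> 0" "\<bar>y\<bar> < pi" for y
    using zcoth_DERIV(2)[of "\<i> * of_real y"] sin_nonzero_strip[OF y(2,1)] y
    by (simp add: imaginary_in_strip sinh_imaginary cosh_imaginary acoef_def power_mult_distrib)
      (simp add: field_simps power3_eq_cube)
  have "((\<lambda>y. (deriv ^^ 2) zcoth (\<i> * of_real y)) \<longlongrightarrow> of_real (2 * (1 / 3))) (at_right 0)"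
  proof (rule Lim_transform_eventually)
    have "((\<lambda>y::real. 2 * ((sin y - y * cos y) / sin y ^ 3)) \<longlongrightarrow> 2 * (1 / 3)) (at_right 0)" by real_asymp
    from tendsto_of_real[OF this]
    show "((\<lambda>y::real. complex_of_real (2 * ((sin y - y * cos y) / sin y ^ 3))) \<longlongrightarrow> of_real (2 * (1 / 3))) (at_right 0)" .
    have "eventually (\<lambda>y. y \<in> {0<..<pi}) (at_right (0::real))"
      by (intro eventually_at_right_real pi_gt_zero)
    then show "\<forall>\<^sub>F y in at_right 0. complex_of_real (2 * ((sin y - y * cos y) / sin y ^ 3)) = (deriv ^^ 2) zcoth (\<i> * of_real y)"
      by eventually_elim (subst *; simp add: acoef_def)
  qed
  from higher_deriv_at_0_limit[OF this] show ?thesis using * assms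
    by (cases "y = 0") (auto simp: acoef_def)
qed

text \<open>sin y \<le> y together with \<open>sin_minus_cos_ge\<close> gives the bound, attained at
  y = 0. It keeps the Gaussian coefficient away from 0 for all saddles and makes theta strictly
  increasing.\<close>

lemma acoef_ge:
  assumes "\<bar>y\<bar> < pi"
  shows "acoef y \<ge> 1 / 3"
proof -
  have *: "acoef y \<ge> 1 / 3" if y: "0 < y" "y < pi" for y
  proof -
    have s: "sin y > 0" using y by (rule sin_gt_zero)
    have "(sin y)\<^sup>2 * sin y \<le> y\<^sup>2 * sin y"
      using s y sin_x_le_x[of y] by (intro mult_right_mono power_mono) auto
    also have "\<dots> \<le> 3 * (sin y - y * cos y)" using sin_minus_cos_ge[of y] y by simp
    finally show ?thesis using s y by (simp add: acoef_def field_simps power2_eq_square power3_eq_cube)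
  qed
  have "acoef (-y) = acoef y" 
    by (cases "sin y = 0") (auto simp: acoef_def field_simps)
  then show ?thesis using *[of y] *[of "-y"] assms by (cases "y = 0"; cases "y > 0") (auto simp: acoef_def)
qed

section \<open>The function theta and its inverse\<close>

lemma hk_theta_DERIV:
  assumes "\<bar>y\<bar> < pi"
  shows "(hk_theta has_real_derivative 2 * acoef y) (at y)"
proof -
  \<comment> \<open>theta is the imaginary part of the derivative of \<open>zcoth\<close> along the
    imaginary axis, so the chain rule differentiates it at every point at once, including y = 0,
    where its definition switches case.\<close>
  have "deriv zcoth holomorphic_on strip"
    using holomorphic_higher_deriv[OF holomorphic_on_zcoth open_strip, of 1] by simp
  then have "(deriv zcoth has_field_derivative (deriv ^^ 2) zcoth (\<i> * of_real y)) (at (\<i> * of_real y))"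
    using assms holomorphic_derivI[OF _ open_strip, of "deriv zcoth" "\<i> * of_real y"]
    by (simp add: imaginary_in_strip numeral_2_eq_2)
  moreover have "((\<lambda>y. \<i> * of_real y) has_vector_derivative \<i>) (at y)"
    by (auto intro!: derivative_eq_intros simp: has_vector_derivative_def scaleR_conv_of_real mult.commute)
  ultimately have "((\<lambda>y. deriv zcoth (\<i> * of_real y)) has_vector_derivative \<i> * of_real (2 * acoef y)) (at y)"
    using field_vector_diff_chain_at[of "\<lambda>y. \<i> * of_real y" \<i> y "deriv zcoth"]
    by (simp add: o_def zcoth_deriv2_imaginary[OF assms])
  then have "((\<lambda>y. Im (deriv zcoth (\<i> * of_real y))) has_vector_derivative 2 * acoef y) (at y)"
    using bounded_linear.has_vector_derivative[OF bounded_linear_Im] by fastforce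
  then have "((\<lambda>y. Im (deriv zcoth (\<i> * of_real y))) has_real_derivative 2 * acoef y) (at y)"
    by (simp add: has_real_derivative_iff_has_vector_derivative)
  then show ?thesis
    by (rule has_field_derivative_transform_within_open[of _ _ _ "{-pi<..<pi}"])
      (use assms in \<open>auto simp: zcoth_deriv_imaginary\<close>)
qed

lemma hk_theta_strict_mono:
  assumes "- pi < a" "a < b" "b < pi"
  shows "hk_theta a < hk_theta b"
proof (rule DERIV_pos_imp_increasing[OF assms(2)])
  fix x assume "a \<le> x" "x \<le> b"
  then have x: "\<bar>x\<bar> < pi" using assms by auto
  then show "\<exists>y. (hk_theta has_real_derivative y) (at x) \<and> 0 < y"
    using hk_theta_DERIV[OF x] acoef_ge[OF x] by (intro exI[of _ "2 * acoef x"]) auto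
qed

lemma hk_theta_surj:
  assumes "\<omega> \<ge> 0"
  shows "\<exists>y. 0 \<le> y \<and> y < pi \<and> hk_theta y = \<omega>"
proof -
  have "filterlim (\<lambda>l::real. (2 * l - sin (2 * l)) / (2 * (sin l)\<^sup>2)) at_top (at_left pi)" by real_asymp
  then have "eventually (\<lambda>l. \<omega> \<le> (2 * l - sin (2 * l)) / (2 * (sin l)\<^sup>2)) (at_left pi)"
    by (simp add: filterlim_at_top)
  moreover have "eventually (\<lambda>l. l \<in> {0<..<pi}) (at_left pi)"
    by (intro eventually_at_left_real pi_gt_zero)
  ultimately have "eventually (\<lambda>l. 0 < l \<and> l < pi \<and> \<omega> \<le> hk_theta l) (at_left pi)"
    by eventually_elim (auto simp: hk_theta_def)
  then obtain b where b: "0 < b" "b < pi" "\<omega> \<le> hk_theta b"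
    by (metis (mono_tags, lifting) eventually_happens' trivial_limit_at_left_real)
  have "\<exists>y\<ge>0. y \<le> b \<and> hk_theta y = \<omega>"
  proof (rule IVT)
    show "hk_theta 0 \<le> \<omega>" using assms by (simp add: hk_theta_def)
    show "\<forall>x. 0 \<le> x \<and> x \<le> b \<longrightarrow> isCont hk_theta x"
      using b by (auto intro!: DERIV_isCont[OF hk_theta_DERIV])
  qed (use b in auto)
  then show ?thesis using b by force
qed

lemma hk_y_eq:
  assumes "- pi < y" "y < pi"
  shows "hk_y (hk_theta y) = y"
  unfolding hk_y_def
proof (rule the_equality)
  fix x assume "x \<in> {-pi<..<pi} \<and> hk_theta x = hk_theta y"
  then show "x = y"
    using hk_theta_strict_mono[of x y] hk_theta_strict_mono[of y x] assms by (cases x y rule: linorder_cases) auto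
qed (use assms in auto)

lemma hk_y_props:
  assumes "\<omega> \<ge> 0"
  shows "0 \<le> hk_y \<omega>" "hk_y \<omega> < pi" "hk_theta (hk_y \<omega>) = \<omega>"
proof -
  obtain y where y: "0 \<le> y" "y < pi" "hk_theta y = \<omega>" using hk_theta_surj[OF assms] by blast
  then have "hk_y \<omega> = y" using hk_y_eq[of y] by auto
  then show "0 \<le> hk_y \<omega>" "hk_y \<omega> < pi" "hk_theta (hk_y \<omega>) = \<omega>" using y by auto
qed

lemma hk_y_mono:
  assumes "0 \<le> a" "a \<le> b"
  shows "hk_y a \<le> hk_y b"
  using hk_theta_strict_mono[of "hk_y b" "hk_y a"] hk_y_props[of a] hk_y_props[of b] assms
  by (cases "hk_y a \<le> hk_y b") auto

section \<open>Shifting the contour\<close>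

text \<open>A primitive g on the convex domain replaces the rectangle contour. Truncated horizontal
  integrals are differences of g at corners; regrouping the four corners leaves two vertical
  increments, small by the decay hypothesis. Dominated convergence then removes the
  truncation.\<close>

lemma contour_shift:
  fixes f :: "complex \<Rightarrow> complex"
  assumes "f holomorphic_on U" "open U" "convex U" "y \<ge> 0"
    and U: "\<And>s v. 0 \<le> v \<Longrightarrow> v \<le> y \<Longrightarrow> Complex s v \<in> U"
    and decay: "\<And>\<epsilon>. \<epsilon> > 0 \<Longrightarrow> \<exists>T. \<forall>s v. T \<le> \<bar>s\<bar> \<and> 0 \<le> v \<and> v \<le> y \<longrightarrow> norm (f (Complex s v)) \<le> \<epsilon>"
    and int: "integrable lborel (\<lambda>s. f (Complex s 0))" "integrable lborel (\<lambda>s. f (Complex s y))"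
  shows "(\<integral>s. f (Complex s 0) \<partial>lborel) = (\<integral>s. f (Complex s y) \<partial>lborel)"
proof -
  obtain g where g: "\<And>z. z \<in> U \<Longrightarrow> (g has_field_derivative f z) (at z within U)"
    by (rule holomorphic_convex_primitive'[OF assms(3,2,1)]) blast
  have g': "(g has_field_derivative f z) (at z)" if "z \<in> U" for z
    using g[OF that] unfolding at_within_open[OF that assms(2)] .
  define J where "J v n = (\<integral>s. indicator {- real n..real n} s *\<^sub>R f (Complex s v) \<partial>lborel)" for v n
  have J: "J v n = g (Complex n v) - g (Complex (- real n) v)" if v: "0 \<le> v" "v \<le> y" for v n
    unfolding J_def
  proof (rule integral_FTC_atLeastAtMost)
    have vd: "((\<lambda>s. Complex s v) has_vector_derivative 1) (at s)" for s
      unfolding has_vector_derivative_def Complex_eq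
      by (auto intro!: derivative_eq_intros simp: scaleR_conv_of_real)
    show "((\<lambda>s. g (Complex s v)) has_vector_derivative f (Complex s v)) (at s within {- real n..real n})" for s
      using field_vector_diff_chain_at[OF vd g'[OF U[OF v]], of s]
      by (simp add: o_def has_vector_derivative_at_within)
    have "continuous_on UNIV (\<lambda>s. Complex s v)"
      using vd by (meson continuous_at_imp_continuous_on has_vector_derivative_continuous)
    then have "continuous_on UNIV (\<lambda>s. f (Complex s v))"
      using holomorphic_on_imp_continuous_on[OF assms(1)] U[OF v]
      by (intro continuous_on_compose2[of U f UNIV]) auto
    then show "continuous_on {- real n..real n} (\<lambda>s. f (Complex s v))"
      by (rule continuous_on_subset) auto
  qed simp
  have lim: "J v \<longlonglongrightarrow> (\<integral>s. f (Complex s v) \<partial>lborel)" if "integrable lborel (\<lambda>s. f (Complex s v))" for v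
    unfolding J_def
  proof (rule integral_dominated_convergence[where w = "\<lambda>s. norm (f (Complex s v))"])
    show "AE s in lborel. (\<lambda>n. indicator {- real n..real n} s *\<^sub>R f (Complex s v)) \<longlonglongrightarrow> f (Complex s v)"
    proof (rule AE_I2)
      fix s :: real
      obtain N where N: "\<bar>s\<bar> \<le> real N" using real_arch_simple by blast
      have "eventually (\<lambda>n. indicator {- real n..real n} s *\<^sub>R f (Complex s v) = f (Complex s v)) sequentially"
        using eventually_ge_at_top[of N] by eventually_elim (use N in \<open>auto simp: indicator_def\<close>)
      then show "(\<lambda>n. indicator {- real n..real n} s *\<^sub>R f (Complex s v)) \<longlonglongrightarrow> f (Complex s v)"
        by (rule tendsto_eventually)
    qed
  qed (use that in \<open>auto simp: indicator_def\<close>)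
  have vert: "norm (g (Complex s 0) - g (Complex s y)) \<le> \<epsilon> * y"
    if "\<And>v. 0 \<le> v \<Longrightarrow> v \<le> y \<Longrightarrow> norm (f (Complex s v)) \<le> \<epsilon>" for s \<epsilon>
  proof -
    let ?S = "closed_segment (Complex s 0) (Complex s y)"
    have S: "\<exists>v. z = Complex s v \<and> 0 \<le> v \<and> v \<le> y" if "z \<in> ?S" for z
      using that assms(4) by (auto simp: closed_segment_same_Re closed_segment_eq_real_ivl complex_eq_iff
          intro!: exI[of _ "Im z"])
    have "norm (g (Complex s 0) - g (Complex s y)) \<le> \<epsilon> * norm (Complex s 0 - Complex s y)"
    proof (rule field_differentiable_bound[of ?S])
      fix z assume "z \<in> ?S"
      from S[OF this] obtain v where v: "z = Complex s v" "0 \<le> v" "v \<le> y" by blast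
      then show "(g has_field_derivative f z) (at z within ?S)" "norm (f z) \<le> \<epsilon>"
        using g' U that by (auto intro: has_field_derivative_at_within)
    qed auto
    also have "norm (Complex s 0 - Complex s y) = y"
      using assms(4) by (simp add: cmod_def)
    finally show ?thesis .
  qed
  have "(\<lambda>n. J 0 n - J y n) \<longlonglongrightarrow> 0"
  proof (rule LIMSEQ_I)
    fix e :: real assume e: "e > 0"
    \<comment> \<open>Each vertical side contributes at most \<epsilon> y; the additional 1 makes
      the bound strict and covers y = 0.\<close>
    define \<epsilon> where "\<epsilon> = e / (2 * y + 1)"
    have \<epsilon>: "\<epsilon> > 0" using e assms(4) by (simp add: \<epsilon>_def)
    obtain T where T: "\<And>s v. T \<le> \<bar>s\<bar> \<Longrightarrow> 0 \<le> v \<Longrightarrow> v \<le> y \<Longrightarrow> norm (f (Complex s v)) \<le> \<epsilon>"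
      using decay[OF \<epsilon>] by blast
    obtain N where N: "T \<le> real N" using real_arch_simple by blast
    have "norm (J 0 n - J y n) < e" if "n \<ge> N" for n
    proof -
      have "J 0 n - J y n = (g (Complex n 0) - g (Complex n y))
          - (g (Complex (- real n) 0) - g (Complex (- real n) y))"
        using assms(4) by (simp add: J)
      also have "norm \<dots> \<le> \<epsilon> * y + \<epsilon> * y"
        using N that by (intro order.trans[OF norm_triangle_ineq4] add_mono vert T) auto
      also have "\<dots> < \<epsilon> * (2 * y + 1)" using \<epsilon> by (simp add: algebra_simps)
      also have "\<dots> = e" using assms(4) by (simp add: \<epsilon>_def)
      finally show ?thesis .
    qed
    then show "\<exists>N. \<forall>n\<ge>N. norm (J 0 n - J y n - 0) < e" by auto
  qed
  moreover have "(\<lambda>n. J 0 n - J y n) \<longlonglongrightarrow> (\<integral>s. f (Complex s 0) \<partial>lborel) - (\<integral>s. f (Complex s y) \<partial>lborel)"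
    by (intro tendsto_diff lim int)
  ultimately show ?thesis using LIMSEQ_unique by force
qed

section \<open>The amplitude and the integral over the shifted line\<close>

definition ampl :: "nat \<Rightarrow> nat \<Rightarrow> nat \<Rightarrow> complex \<Rightarrow> complex" where
  "ampl n k1 k2 z = (1 / sinhc z) ^ n * zcoth z ^ k1 * z ^ k2"

lemma holomorphic_on_ampl: "ampl n k1 k2 holomorphic_on strip"
  unfolding ampl_def[abs_def]
  by (intro holomorphic_intros holomorphic_on_sinhc holomorphic_on_zcoth sinhc_nonzero)

text \<open>For |s| \<ge> 2: |z| \<le> |s| + 4 \<le> 3|s| and |sinh z| \<ge> |sinh s| \<ge> |s|, so
  z / sinh z is bounded by 3. Moreover |cosh z| \<le> cosh s \<le> 2 |sinh s|, so z coth z is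
  bounded by 6|s|.\<close>

lemma norm_ampl_le:
  assumes y: "0 \<le> y" "y < pi" and s: "\<bar>s\<bar> \<ge> 2"
  shows "norm (ampl n k1 k2 (Complex s y)) \<le> (3 ^ n * 6 ^ k1 * 3 ^ k2) * \<bar>s\<bar> ^ (k1 + k2)"
proof -
  let ?z = "Complex s y"
  have z: "?z \<noteq> 0" using s by (auto simp: complex_eq_iff)
  have "norm ?z \<le> \<bar>s\<bar> + \<bar>y\<bar>" using cmod_le[of ?z] by simp
  then have nz: "norm ?z \<le> 3 * \<bar>s\<bar>" using y s pi_less_4 by linarith
  have "\<bar>sinh s\<bar>\<^sup>2 \<le> (norm (sinh ?z))\<^sup>2" by (simp add: norm_sinh_squared)
  then have ns: "\<bar>sinh s\<bar> \<le> norm (sinh ?z)" by (rule power2_le_imp_le) simp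
  have sh: "\<bar>s\<bar> \<le> \<bar>sinh s\<bar>" using x_le_sinh[of "\<bar>s\<bar>"] by simp
  then have pos: "norm (sinh ?z) > 0" using ns s by linarith
  have "(cosh s)\<^sup>2 \<le> (2 * \<bar>sinh s\<bar>)\<^sup>2"
    using sh s power_mono[of 1 "\<bar>sinh s\<bar>" 2] by (simp add: cosh_square_eq power_mult_distrib)
  then have "cosh s \<le> 2 * \<bar>sinh s\<bar>" by (rule power2_le_imp_le) simp
  then have nc: "norm (cosh ?z) \<le> 2 * norm (sinh ?z)" using norm_cosh_le[of ?z] ns by simp
  have 1: "norm (1 / sinhc ?z) \<le> 3"
    using nz ns sh pos z by (simp add: sinhc_def norm_divide field_simps)
  have 2: "norm (zcoth ?z) \<le> 6 * \<bar>s\<bar>"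
  proof -
    have "norm (zcoth ?z) = norm ?z * norm (cosh ?z) / norm (sinh ?z)"
      by (simp add: zcoth_nonzero_eq[OF z] norm_mult norm_divide)
    also have "\<dots> \<le> (3 * \<bar>s\<bar>) * (2 * norm (sinh ?z)) / norm (sinh ?z)"
      using nz nc by (intro divide_right_mono mult_mono) auto
    finally show ?thesis using pos by simp
  qed
  have "norm (ampl n k1 k2 ?z) = norm (1 / sinhc ?z) ^ n * norm (zcoth ?z) ^ k1 * norm ?z ^ k2"
    by (simp only: ampl_def norm_mult norm_power)
  also have "\<dots> \<le> 3 ^ n * (6 * \<bar>s\<bar>) ^ k1 * (3 * \<bar>s\<bar>) ^ k2"
    by (intro mult_mono power_mono 1 2 nz) auto
  also have "\<dots> = (3 ^ n * 6 ^ k1 * 3 ^ k2) * \<bar>s\<bar> ^ (k1 + k2)"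
    by (simp add: power_mult_distrib power_add)
  finally show ?thesis .
qed

text \<open>The saddle y is the parameter and \<omega> = theta(y) is derived from it. The
  exponential prefactor cancels the value of the integrand's exponential at the saddle. The bound on
  \<open>acoef\<close> serves later, when the error is divided by the Gaussian factor.\<close>

lemma heat_integral_asymptotics:
  fixes n k1 k2 :: nat and Y :: real
  assumes "0 \<le> Y" "Y < pi"
  shows "\<exists>L\<ge>0. \<forall>y R. 0 \<le> y \<and> y \<le> Y \<and> R \<ge> 1 \<longrightarrow> acoef y \<le> L \<and>
    norm (exp (of_real (R * (hk_theta y * y + ycot y))) *
        (\<integral>l. exp (\<i> * of_real (R * hk_theta y * l) - of_real R * zcoth (of_real l)) * ampl n k1 k2 (of_real l) \<partial>lborel)
      - ampl n k1 k2 (\<i> * of_real y) * of_real (sqrt (pi / (acoef y * R)))) \<le> L / (R * sqrt R)"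
proof -
  let ?a = "ampl n k1 k2"
  \<comment> \<open>A compact rectangle in the strip containing every admissible saddle and the part
    |s| \<le> 2 of its horizontal line; all Taylor constants are taken on it.\<close>
  define S where "S = cbox (Complex (-2) 0) (Complex 2 Y)"
  have S: "Complex s y \<in> S" if "\<bar>s\<bar> \<le> 2" "0 \<le> y" "y \<le> Y" for s y
    using that by (auto simp: S_def in_cbox_complex_iff)
  have Sprops: "compact S" "convex S" "S \<subseteq> strip"
    using assms by (auto simp: S_def in_cbox_complex_iff strip_def)
  obtain K1 where K1: "K1 \<ge> 0" "\<And>k z. k \<le> 4 \<Longrightarrow> z \<in> S \<Longrightarrow> norm ((deriv ^^ k) zcoth z) \<le> K1"
    "\<And>w z. w \<in> S \<Longrightarrow> z \<in> S \<Longrightarrow>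
        norm (zcoth z - (\<Sum>i\<le>3. (deriv ^^ i) zcoth w * (z - w) ^ i / fact i)) \<le> K1 * norm (z - w) ^ 4"
    using holomorphic_uniform_taylor[OF holomorphic_on_zcoth open_strip Sprops, of 3] by auto
  obtain K2 where K2: "K2 \<ge> 0" "\<And>k z. k \<le> 2 \<Longrightarrow> z \<in> S \<Longrightarrow> norm ((deriv ^^ k) ?a z) \<le> K2"
    "\<And>w z. w \<in> S \<Longrightarrow> z \<in> S \<Longrightarrow>
        norm (?a z - (\<Sum>i\<le>1. (deriv ^^ i) ?a w * (z - w) ^ i / fact i)) \<le> K2 * norm (z - w) ^ 2"
    using holomorphic_uniform_taylor[OF holomorphic_on_ampl open_strip Sprops, of 1 n k1 k2]
    by (auto simp: numeral_2_eq_2)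
  define K3 :: real where "K3 = 3 ^ n * 6 ^ k1 * 3 ^ k2"
  define K where "K = K1 + K2 + K3"
  have K3: "K3 \<ge> 0" by (simp add: K3_def)
  have K: "K \<ge> 0" "K1 \<le> K" "K2 \<le> K" "K3 \<le> K" using K1(1) K2(1) K3 by (auto simp: K_def)
  \<comment> \<open>One c has to serve three purposes: coercivity for |s| \<le> 2, the slope 1/4 for
    |s| \<ge> 2, and the bound \<open>acoef y\<close> \<ge> 1/3. The last two follow from c \<le>
    1/6.\<close>
  define c :: real where "c = 1 / (3 * cosh 2)"
  have "cosh (2::real) \<ge> 2" using sinh_le_cosh_real[of 2] x_le_sinh[of 2] by simp
  then have c: "c > 0" "c \<le> 1 / 6" by (auto simp: c_def field_simps)
  obtain L where L: "L \<ge> 0" and lap0: "\<forall>(h :: real \<Rightarrow> complex) (a :: real \<Rightarrow> complex) A B a0 a1 R.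
    R \<ge> 1 \<and> c \<le> A \<and> norm B \<le> K \<and> norm a0 \<le> K \<and> norm a1 \<le> K \<and>
    continuous_on UNIV h \<and> continuous_on UNIV a \<and>
    (\<forall>s. \<bar>s\<bar> \<le> 2 \<longrightarrow> c * s\<^sup>2 \<le> Re (h s) \<and>
       norm (h s - of_real (A * s\<^sup>2) - B * of_real s ^ 3) \<le> K * s ^ 4 \<and>
       norm (a s - a0 - a1 * of_real s) \<le> K * s\<^sup>2) \<and>
    (\<forall>s. \<bar>s\<bar> \<ge> 2 \<longrightarrow> c * \<bar>s\<bar> \<le> Re (h s) \<and> norm (a s) \<le> K * \<bar>s\<bar> ^ (k1 + k2)) \<longrightarrow>
    integrable lborel (\<lambda>s. exp (- (of_real R * h s)) * a s) \<and>
    norm ((\<integral>s. exp (- (of_real R * h s)) * a s \<partial>lborel) - a0 * of_real (sqrt (pi / (A * R))))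
     \<le> L / (R * sqrt R)"
    using laplace_uniform[OF c(1) K(1), of "k1 + k2"] by (elim exE conjE) (rule that)
  note lap = lap0[rule_format]
  have Cx: "Complex s y = of_real s + \<i> * of_real y" for s y by (simp add: complex_eq_iff)
  \<comment> \<open>-R h is the exponent on the shifted line minus its value at the saddle; the term
    with \<open>hk_theta y\<close> cancels the linear Taylor term of \<open>zcoth\<close>.\<close>
  define h where "h y s = zcoth (Complex s y) - zcoth (\<i> * of_real y) - \<i> * of_real (hk_theta y * s)" for y s
  have cont: "continuous_on UNIV (\<lambda>s. f (Complex s y))" if "f holomorphic_on strip" "0 \<le> y" "y \<le> Y" for f y
  proof (rule continuous_on_compose2[OF holomorphic_on_imp_continuous_on[OF that(1)]])
    show "continuous_on UNIV (\<lambda>s. Complex s y)" unfolding Cx by (intro continuous_intros)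
    show "(\<lambda>s. Complex s y) ` UNIV \<subseteq> strip" using that assms by (auto simp: strip_def)
  qed
  have lap': "integrable lborel (\<lambda>s. exp (- (of_real R * h y s)) * ?a (Complex s y)) \<and>
    norm ((\<integral>s. exp (- (of_real R * h y s)) * ?a (Complex s y) \<partial>lborel)
      - ?a (\<i> * of_real y) * of_real (sqrt (pi / (acoef y * R)))) \<le> L / (R * sqrt R)"
    if y: "0 \<le> y" "y \<le> Y" and R: "R \<ge> 1" for y R
  proof (rule lap[where B = "(deriv ^^ 3) zcoth (\<i> * of_real y) / 6" and ?a1.0 = "deriv ?a (\<i> * of_real y)"],
      intro conjI allI impI)
    have ypi: "y < pi" "\<bar>y\<bar> < pi" using y assms by auto
    have w: "\<i> * of_real y \<in> S" using S[of 0 y] y by (simp add: Cx)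
    show "1 \<le> R" by (rule R)
    show "c \<le> acoef y" using acoef_ge[OF ypi(2)] c by simp
    show "norm ((deriv ^^ 3) zcoth (\<i> * of_real y) / 6) \<le> K"
      using K1(2)[OF _ w, of 3] K by (simp add: norm_divide)
    show "norm (?a (\<i> * of_real y)) \<le> K" using K2(2)[OF _ w, of 0] K by simp
    show "norm (deriv ?a (\<i> * of_real y)) \<le> K" using K2(2)[OF _ w, of 1] K by simp
    show "continuous_on UNIV (h y)" unfolding h_def
      by (intro continuous_intros cont holomorphic_on_zcoth y)
    show "continuous_on UNIV (\<lambda>s. ?a (Complex s y))" by (intro cont holomorphic_on_ampl y)
    have Reh: "Re (h y s) = Re (zcoth (Complex s y)) - ycot y" for s
      by (simp add: h_def zcoth_imaginary)
    fix s :: real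
    {
      assume s: "\<bar>s\<bar> \<le> 2"
      have z: "Complex s y \<in> S" using S s y by simp
      have zw: "Complex s y - \<i> * of_real y = of_real s" by (simp add: Cx)
      show "c * s\<^sup>2 \<le> Re (h y s)" using Re_zcoth_ge(1)[OF y(1) ypi(1) s] by (simp add: Reh c_def)
      have "norm (zcoth (Complex s y) - (\<Sum>i\<le>3. (deriv ^^ i) zcoth (\<i> * of_real y) * of_real s ^ i / fact i)) \<le> K1 * s ^ 4"
        using K1(3)[OF w z] by (simp add: zw power_even_abs)
      also have "(\<Sum>i\<le>3. (deriv ^^ i) zcoth (\<i> * of_real y) * of_real s ^ i / fact i) =
          zcoth (\<i> * of_real y) + \<i> * of_real (hk_theta y) * of_real s + of_real (acoef y * s\<^sup>2) +
          (deriv ^^ 3) zcoth (\<i> * of_real y) / 6 * of_real s ^ 3"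
        using zcoth_deriv2_imaginary[OF ypi(2)] zcoth_deriv_imaginary[OF ypi(2)]
        by (simp add: eval_nat_numeral)
      finally have "norm (h y s - of_real (acoef y * s\<^sup>2) - (deriv ^^ 3) zcoth (\<i> * of_real y) / 6 * of_real s ^ 3) \<le> K1 * s ^ 4"
        by (simp add: h_def algebra_simps)
      then show "norm (h y s - of_real (acoef y * s\<^sup>2) - (deriv ^^ 3) zcoth (\<i> * of_real y) / 6 * of_real s ^ 3) \<le> K * s ^ 4"
        using mult_right_mono[OF K(2), of "s ^ 4"] by simp
      show "norm (?a (Complex s y) - ?a (\<i> * of_real y) - deriv ?a (\<i> * of_real y) * of_real s) \<le> K * s\<^sup>2"
        using K2(3)[OF w z] mult_right_mono[OF K(3), of "s\<^sup>2"] by (simp add: zw algebra_simps)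
    }
    {
      assume s: "2 \<le> \<bar>s\<bar>"
      have "c * \<bar>s\<bar> \<le> 1 / 4 * \<bar>s\<bar>" using c by (intro mult_right_mono) auto
      then show "c * \<bar>s\<bar> \<le> Re (h y s)" using Re_zcoth_ge(2)[OF y(1) ypi(1) s] by (simp add: Reh)
      show "norm (?a (Complex s y)) \<le> K * \<bar>s\<bar> ^ (k1 + k2)"
        using norm_ampl_le[OF y(1) ypi(1) s, of n k1 k2] mult_right_mono[OF K(4), of "\<bar>s\<bar> ^ (k1 + k2)"]
        by (simp add: K3_def)
    }
  qed
  have main: "norm (exp (of_real (R * (hk_theta y * y + ycot y))) *
        (\<integral>l. exp (\<i> * of_real (R * hk_theta y * l) - of_real R * zcoth (of_real l)) * ?a (of_real l) \<partial>lborel)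
      - ?a (\<i> * of_real y) * of_real (sqrt (pi / (acoef y * R)))) \<le> L / (R * sqrt R)"
    if y: "0 \<le> y" "y \<le> Y" and R: "R \<ge> 1" for y R
  proof -
    define f where "f z = exp (\<i> * of_real (R * hk_theta y) * z - of_real R * zcoth z) * ?a z" for z
    define q where "q = exp (of_real (R * (hk_theta y * y + ycot y)) :: complex)"
    have q0: "q \<noteq> 0" by (simp add: q_def)
    have hol: "f holomorphic_on strip" unfolding f_def
      by (intro holomorphic_intros holomorphic_on_zcoth holomorphic_on_ampl)
    have fy: "q * f (Complex s y) = exp (- (of_real R * h y s)) * ?a (Complex s y)" for s
      unfolding f_def q_def h_def mult.assoc[symmetric] exp_add[symmetric] zcoth_imaginary
      by (simp add: Cx algebra_simps)
    have "integrable lborel (\<lambda>s. q * f (Complex s y))" unfolding fy using lap'[OF y R] by simp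
    from integrable_mult_right[OF this, of "inverse q"]
    have int_y: "integrable lborel (\<lambda>s. f (Complex s y))" by (simp add: q0 flip: mult.assoc)
    \<comment> \<open>On the real line the factor exp(\<i> R \<omega> s) has modulus 1, so
      integrability there follows from the Laplace estimate with saddle y = 0; exp(-R) enters
      through \<open>zcoth 0 = 1\<close>.\<close>
    have f0: "norm (f (Complex s 0)) = norm (exp (- of_real R) * (exp (- (of_real R * h 0 s)) * ?a (Complex s 0)))" for s
      by (simp add: f_def h_def norm_mult hk_theta_def Cx algebra_simps flip: exp_add)
    have int_0: "integrable lborel (\<lambda>s. f (Complex s 0))"
    proof (rule Bochner_Integration.integrable_bound)
      show "integrable lborel (\<lambda>s. exp (- of_real R) * (exp (- (of_real R * h 0 s)) * ?a (Complex s 0)))"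
        using lap'[OF order_refl assms(1) R] by simp
      show "(\<lambda>s. f (Complex s 0)) \<in> borel_measurable lborel"
        using cont[OF hol order_refl assms(1)] by (simp add: borel_measurable_continuous_onI)
    qed (rule AE_I2, simp only: f0 order_refl)
    \<comment> \<open>One power more than the growth of the amplitude, so that a factor 1/|s|
      remains and the vertical sides vanish in the limit.\<close>
    obtain k where k: "k \<ge> 0" "\<And>v. v \<ge> 0 \<Longrightarrow> v ^ (k1 + k2 + 1) * exp (- (R / 4 * v)) \<le> k"
      using power_times_exp_bounded[of "R / 4" "k1 + k2 + 1"] R by auto
    have fle: "norm (f (Complex s v)) \<le> exp (R * K1) * K3 * k / \<bar>s\<bar>" if s: "2 \<le> \<bar>s\<bar>" and v: "0 \<le> v" "v \<le> y" for s v
    proof -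
      have vpi: "v < pi" using v y assms by simp
      have "norm (zcoth (\<i> * of_real v)) \<le> K1"
        using K1(2)[of 0 "\<i> * of_real v"] S[of 0 v] v y by (simp add: Cx)
      then have "- K1 \<le> ycot v" by (simp add: zcoth_imaginary)
      then have "- K1 + \<bar>s\<bar> / 4 \<le> Re (zcoth (Complex s v))" using Re_zcoth_ge(2)[OF v(1) vpi s] by linarith
      then have "R * (- K1 + \<bar>s\<bar> / 4) \<le> R * Re (zcoth (Complex s v))" using R by (intro mult_left_mono) auto
      moreover have "R * hk_theta y * v \<ge> 0"
      proof -
        have "hk_theta y \<ge> 0" using y assms hk_theta_strict_mono[of 0 y]
          by (cases "y = 0") (auto simp: hk_theta_def)
        then show ?thesis using R v by simp
      qed
      ultimately have e: "norm (exp (\<i> * of_real (R * hk_theta y) * Complex s v - of_real R * zcoth (Complex s v)))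
          \<le> exp (R * K1) * exp (- (R / 4 * \<bar>s\<bar>))"
        by (simp add: algebra_simps flip: exp_add)
      have "norm (f (Complex s v)) \<le> (exp (R * K1) * exp (- (R / 4 * \<bar>s\<bar>))) * (K3 * \<bar>s\<bar> ^ (k1 + k2))"
        unfolding f_def norm_mult K3_def by (intro mult_mono e norm_ampl_le v vpi s) auto
      also have "\<dots> = exp (R * K1) * K3 * (\<bar>s\<bar> ^ (k1 + k2 + 1) * exp (- (R / 4 * \<bar>s\<bar>))) / \<bar>s\<bar>"
        using s by (auto simp: field_simps)
      also have "\<dots> \<le> exp (R * K1) * K3 * k / \<bar>s\<bar>"
        using k(2)[of "\<bar>s\<bar>"] K3 by (intro divide_right_mono mult_left_mono) auto
      finally show ?thesis .
    qed
    have "(\<integral>s. f (Complex s 0) \<partial>lborel) = (\<integral>s. f (Complex s y) \<partial>lborel)"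
    proof (rule contour_shift[OF hol open_strip convex_strip y(1) _ _ int_0 int_y])
      show "Complex s v \<in> strip" if "0 \<le> v" "v \<le> y" for s v
        using that y assms by (simp add: strip_def)
      fix \<epsilon> :: real assume \<epsilon>: "\<epsilon> > 0"
      let ?T = "max 2 (exp (R * K1) * K3 * k / \<epsilon>)"
      show "\<exists>T. \<forall>s v. T \<le> \<bar>s\<bar> \<and> 0 \<le> v \<and> v \<le> y \<longrightarrow> norm (f (Complex s v)) \<le> \<epsilon>"
      proof (intro exI[of _ ?T] allI impI)
        fix s v assume sv: "?T \<le> \<bar>s\<bar> \<and> 0 \<le> v \<and> v \<le> y"
        then have "exp (R * K1) * K3 * k / \<bar>s\<bar> \<le> \<epsilon>" using \<epsilon> by (auto simp: field_simps)
        then show "norm (f (Complex s v)) \<le> \<epsilon>" using fle[of s v] sv by simp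
      qed
    qed
    then have "q * (\<integral>s. f (Complex s 0) \<partial>lborel) = (\<integral>s. exp (- (of_real R * h y s)) * ?a (Complex s y) \<partial>lborel)"
      by (simp flip: fy)
    then show ?thesis using lap'[OF y R]
      by (simp add: q_def f_def Cx mult.assoc)
  qed
  have ac: "acoef y \<le> K1" if "0 \<le> y" "y \<le> Y" for y
  proof -
    have "norm ((deriv ^^ 2) zcoth (\<i> * of_real y)) \<le> K1"
      using K1(2)[of 2 "\<i> * of_real y"] S[of 0 y] that by (simp add: Cx)
    then show ?thesis using zcoth_deriv2_imaginary[of y] acoef_ge[of y] that assms by simp
  qed
  have mono: "L / (R * sqrt R) \<le> max L K1 / (R * sqrt R)" if "R \<ge> 1" for R
    using that by (intro divide_right_mono) auto
  show ?thesis
  proof (rule exI[of _ "max L K1"], intro conjI[of "0 \<le> max L K1"] allI impI)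
    show "0 \<le> max L K1" using L by simp
    fix y R :: real assume a: "0 \<le> y \<and> y \<le> Y \<and> 1 \<le> R"
    then have yR: "0 \<le> y" "y \<le> Y" "1 \<le> R" by simp_all
    show "acoef y \<le> max L K1 \<and>
      norm (exp (of_real (R * (hk_theta y * y + ycot y))) *
        (\<integral>l. exp (\<i> * of_real (R * hk_theta y * l) - of_real R * zcoth (of_real l)) * ?a (of_real l) \<partial>lborel)
      - ?a (\<i> * of_real y) * of_real (sqrt (pi / (acoef y * R)))) \<le> max L K1 / (R * sqrt R)"
      by (rule conjI[OF max.coboundedI2[OF ac[OF yR(1,2)]] order.trans[OF main[OF yR] mono[OF yR(3)]]])
  qed
qed

section \<open>The heat kernel\<close>

text \<open>The absolute values disappear because l / sinh l and cosh l are even, which exposes an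
  integrand with a holomorphic extension.\<close>

lemma hk_p_eq:
  assumes "n \<ge> 1"
  shows "hk_p n k1 k2 (x :: real ^ 'd) t = (-1) ^ k1 * \<i> ^ k2 / complex_of_real ((4 * pi) ^ n * (2 * pi)) *
    (\<integral>l. exp (\<i> * of_real (\<bar>t\<bar> * l) - of_real ((norm x)\<^sup>2 / 4) * zcoth (of_real l)) *
      ampl n k1 k2 (of_real l) \<partial>lborel)"
proof -
  have eq: "exp (\<i> * complex_of_real (\<bar>t\<bar> * l)
             - complex_of_real ((norm x)\<^sup>2 / 4 * \<bar>l\<bar> * cosh \<bar>l\<bar> / sinh \<bar>l\<bar>)) *
        complex_of_real (\<bar>l\<bar> ^ (n + k1) * (cosh \<bar>l\<bar>) ^ k1 / (sinh \<bar>l\<bar>) ^ (n + k1) * l ^ k2)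
     = exp (\<i> * of_real (\<bar>t\<bar> * l) - of_real ((norm x)\<^sup>2 / 4) * zcoth (of_real l)) * ampl n k1 k2 (of_real l)"
    if l: "l \<noteq> 0" for l
  proof -
    have sc: "sinh (of_real l) = complex_of_real (sinh l)" "cosh (of_real l) = complex_of_real (cosh l)"
      by (simp_all add: complex_eq_iff complex_sinh_cosh)
    have z: "zcoth (of_real l) = of_real (l * cosh l / sinh l)" "1 / sinhc (of_real l) = of_real (l / sinh l)"
      using l by (simp_all add: zcoth_nonzero_eq sinhc_def sc)
    have abs: "\<bar>l\<bar> / sinh \<bar>l\<bar> = l / sinh l" by (cases "l > 0") auto
    have "(norm x)\<^sup>2 / 4 * \<bar>l\<bar> * cosh \<bar>l\<bar> / sinh \<bar>l\<bar> = (norm x)\<^sup>2 / 4 * (\<bar>l\<bar> / sinh \<bar>l\<bar>) * cosh l"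
      by simp
    also have "\<dots> = (norm x)\<^sup>2 / 4 * (l * cosh l / sinh l)" unfolding abs by simp
    finally have e: "(norm x)\<^sup>2 / 4 * \<bar>l\<bar> * cosh \<bar>l\<bar> / sinh \<bar>l\<bar> = (norm x)\<^sup>2 / 4 * (l * cosh l / sinh l)" .
    have "\<bar>l\<bar> ^ (n + k1) * (cosh \<bar>l\<bar>) ^ k1 / (sinh \<bar>l\<bar>) ^ (n + k1) * l ^ k2
        = (\<bar>l\<bar> / sinh \<bar>l\<bar>) ^ (n + k1) * cosh l ^ k1 * l ^ k2"
      by (simp add: power_divide)
    also have "\<dots> = (l / sinh l) ^ n * (l * cosh l / sinh l) ^ k1 * l ^ k2"
      unfolding abs by (simp add: power_add power_divide power_mult_distrib)
    finally have "ampl n k1 k2 (of_real l) =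
        of_real (\<bar>l\<bar> ^ (n + k1) * (cosh \<bar>l\<bar>) ^ k1 / (sinh \<bar>l\<bar>) ^ (n + k1) * l ^ k2)"
      unfolding ampl_def z by simp
    then show ?thesis unfolding e z(1) by simp
  qed
  have [measurable]: "(sinh :: real \<Rightarrow> real) \<in> borel_measurable borel" "(cosh :: real \<Rightarrow> real) \<in> borel_measurable borel"
    by (intro borel_measurable_continuous_onI continuous_intros)+
  have "(\<lambda>l. f (complex_of_real l)) \<in> borel_measurable borel" if "f holomorphic_on strip" for f
    by (intro borel_measurable_continuous_onI
        continuous_on_compose2[OF holomorphic_on_imp_continuous_on[OF that]] continuous_intros)
      (auto simp: strip_def)
  note [measurable] = this[OF holomorphic_on_zcoth] this[OF holomorphic_on_ampl]
  let ?f = "\<lambda>l. exp (\<i> * complex_of_real (\<bar>t\<bar> * l)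
             - complex_of_real ((norm x)\<^sup>2 / 4 * \<bar>l\<bar> * cosh \<bar>l\<bar> / sinh \<bar>l\<bar>)) *
        complex_of_real (\<bar>l\<bar> ^ (n + k1) * (cosh \<bar>l\<bar>) ^ k1 / (sinh \<bar>l\<bar>) ^ (n + k1) * l ^ k2)"
  let ?g = "\<lambda>l. exp (\<i> * of_real (\<bar>t\<bar> * l) - of_real ((norm x)\<^sup>2 / 4) * zcoth (of_real l)) *
        ampl n k1 k2 (of_real l)"
  have "?f \<in> borel_measurable lborel" by measurable
  moreover have "?g \<in> borel_measurable lborel" by measurable
  \<comment> \<open>At l = 0 division by zero gives \<open>?f\<close> the value 0, whereas
    \<open>?g\<close> takes the continuous extension.\<close>
  moreover have "AE l in lborel. ?f l = ?g l"
    using AE_lborel_singleton[of 0] by (rule eventually_mono) (rule eq)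
  ultimately have "integral\<^sup>L lborel ?f = integral\<^sup>L lborel ?g" by (rule integral_cong_AE)
  then show ?thesis by (simp only: hk_p_def)
qed

text \<open>The factor \<i>^k2 of the kernel meets another one from z^k2 at z = \<i> y, which
  produces (-1)^k2; in z / sinh z the units cancel since sinh(\<i> y) = \<i> sin y.\<close>

lemma ampl_imaginary:
  "(-1) ^ k1 * \<i> ^ k2 * ampl n k1 k2 (\<i> * of_real y) = of_real ((-1) ^ (k1 + k2) * hk_frac n k1 k2 y)"
proof -
  have i: "\<i> ^ k2 * \<i> ^ k2 = (-1) ^ k2" by (simp flip: power_mult_distrib)
  have a: "ampl n k1 k2 (\<i> * of_real y) = \<i> ^ k2 * of_real (hk_frac n k1 k2 y)"
  proof (cases "y = 0")
    case True
    then show ?thesis by (simp add: ampl_def hk_frac_def sinhc_def)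
  next
    case False
    then have "1 / sinhc (\<i> * of_real y) = of_real (y / sin y)"
      by (simp add: sinhc_def sinh_imaginary)
    then show ?thesis using False
      unfolding ampl_def zcoth_imaginary
      by (simp add: hk_frac_def ycot_def power_add power_divide power_mult_distrib)
  qed
  show ?thesis unfolding a using i by (simp add: power_add)
qed

text \<open>With \<omega> = (y - sin y cos y) / sin^2 y the cosine terms cancel in \<omega> y + y
  cot y and leave (y / sin y)^2. Thus the saddle value of the exponent is the squared distance over
  4.\<close>

lemma hk_d_exponent:
  assumes "x \<noteq> 0"
  shows "(hk_d x t)\<^sup>2 / 4 = (norm x)\<^sup>2 / 4 *
    (hk_omega x t * hk_y (hk_omega x t) + ycot (hk_y (hk_omega x t)))"
proof (cases "t = 0")
  case True
  then have "hk_omega x t = 0" by (simp add: hk_omega_def)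
  moreover have "hk_y 0 = 0" using hk_y_eq[of 0] by (simp add: hk_theta_def)
  ultimately show ?thesis using True by (simp add: hk_d_def ycot_def)
next
  case False
  define \<omega> where "\<omega> = hk_omega x t"
  define y where "y = hk_y \<omega>"
  have \<omega>: "\<omega> > 0" using assms False by (simp add: \<omega>_def hk_omega_def)
  then have y: "0 \<le> y" "y < pi" "hk_theta y = \<omega>" using hk_y_props[of \<omega>] by (auto simp: y_def)
  then have y0: "y \<noteq> 0" using \<omega> by (auto simp: hk_theta_def)
  then have s: "sin y \<noteq> 0" using sin_nonzero_strip[of y] y by simp
  have "\<omega> = (2 * (y - sin y * cos y)) / (2 * (sin y)\<^sup>2)"
    using y(3) y0 unfolding hk_theta_def sin_double by (simp add: algebra_simps)
  then have *: "\<omega> = (y - sin y * cos y) / (sin y)\<^sup>2" by (simp only: mult_divide_mult_cancel_left_if) simp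
  have "\<omega> * y + ycot y = ((y - sin y * cos y) * y + y * cos y * sin y) / (sin y)\<^sup>2"
    using y0 s unfolding * by (simp add: ycot_def field_simps power2_eq_square)
  also have "\<dots> = (y / sin y)\<^sup>2" by (simp add: power_divide power2_eq_square algebra_simps)
  finally show ?thesis using assms False
    by (simp add: hk_d_def power_divide power_mult_distrib flip: \<omega>_def y_def)
qed

lemma hk_Psi_eq:
  assumes "\<omega> \<ge> 0"
  shows "hk_Psi n \<omega> = sqrt (pi / acoef (hk_y \<omega>)) / (4 ^ n * pi ^ (n + 1))"
proof (cases "\<omega> = 0")
  case True
  moreover have "hk_y 0 = 0" using hk_y_eq[of 0] by (simp add: hk_theta_def)
  ultimately show ?thesis by (simp add: hk_Psi_def acoef_def mult.commute)
next
  case False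
  then have "hk_y \<omega> \<noteq> 0" using hk_y_props[OF assms] by (auto simp: hk_theta_def)
  then show ?thesis using False by (simp add: hk_Psi_def acoef_def)
qed

theorem theorem3p3:
  fixes n k1 k2 :: nat and C :: real
  assumes "n \<ge> 1" and "CARD('d) = 2 * n" and "C > 0"
  shows "\<exists>K M. \<forall>(x :: real ^ 'd) (t :: real).
     x \<noteq> 0 \<and> norm (x, t) \<ge> M \<and> 0 \<le> hk_omega x t \<and> hk_omega x t \<le> C \<longrightarrow>
     (\<exists>E :: complex. norm E \<le> K / (norm x)\<^sup>2 \<and>
        hk_p n k1 k2 x t =
          complex_of_real (1 / norm x * exp (- (hk_d x t)\<^sup>2 / 4) * hk_Psi n (hk_omega x t)) *
          (complex_of_real ((-1) ^ (k1 + k2) * hk_frac n k1 k2 (hk_y (hk_omega x t))) + E))"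
proof -
  obtain L where L: "L \<ge> 0" and asymp: "\<forall>y R. 0 \<le> y \<and> y \<le> hk_y C \<and> R \<ge> 1 \<longrightarrow> acoef y \<le> L \<and>
    norm (exp (of_real (R * (hk_theta y * y + ycot y))) *
        (\<integral>l. exp (\<i> * of_real (R * hk_theta y * l) - of_real R * zcoth (of_real l)) * ampl n k1 k2 (of_real l) \<partial>lborel)
      - ampl n k1 k2 (\<i> * of_real y) * of_real (sqrt (pi / (acoef y * R)))) \<le> L / (R * sqrt R)"
    using heat_integral_asymptotics[of "hk_y C" n k1 k2] hk_y_props[of C] assms(3) by auto
  show ?thesis
  \<comment> \<open>The first witness is L R^(-3/2) divided by the Gaussian factor 2q/|x|, with R =
    |x|^2/4 and 1/q \<le> sqrt(L/pi). The second forces |x| \<ge> 2, that is R \<ge> 1: otherwise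
    |t| = R \<omega> \<le> C and the norm of (x, t) would be below 2 + C.\<close>
  proof (rule exI[of _ "4 * L * sqrt (L / pi)"], rule exI[of _ "2 + C"], intro allI impI, elim conjE)
    fix x :: "real ^ 'd" and t :: real
    assume x: "x \<noteq> 0" and far: "2 + C \<le> norm (x, t)" and om: "0 \<le> hk_omega x t" "hk_omega x t \<le> C"
    define \<omega> where "\<omega> = hk_omega x t"
    define y where "y = hk_y \<omega>"
    define R where "R = (norm x)\<^sup>2 / 4"
    define q where "q = sqrt (pi / acoef y)"
    have nx: "norm x > 0" using x by simp
    have y: "0 \<le> y" "y < pi" "hk_theta y = \<omega>" "y \<le> hk_y C"
      using hk_y_props[of \<omega>] hk_y_mono[of \<omega> C] om by (auto simp: y_def \<omega>_def)
    have tR: "\<bar>t\<bar> = R * \<omega>" using nx by (simp add: R_def \<omega>_def hk_omega_def)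
    have x2: "norm x \<ge> 2"
    proof (rule ccontr)
      assume "\<not> norm x \<ge> 2"
      then have x: "norm x < 2" by simp
      then have "R \<le> 1" using power_mono[of "norm x" 2 2] by (simp add: R_def)
      then have "R * \<omega> \<le> 1 * C" using om by (intro mult_mono) (auto simp: \<omega>_def)
      moreover have "norm (x, t) \<le> norm x + \<bar>t\<bar>"
        using sqrt_sum_squares_le_sum_abs[of "norm x" "\<bar>t\<bar>"] by (simp add: norm_Pair)
      ultimately show False using far x by (simp add: tR)
    qed
    then have R: "R \<ge> 1" using power_mono[of 2 "norm x" 2] by (simp add: R_def)
    have sqrtR: "sqrt R = norm x / 2" by (simp add: R_def real_sqrt_divide)
    have ac: "acoef y \<ge> 1 / 3" "acoef y \<le> L" using acoef_ge[of y] y asymp R by auto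
    define I where "I = (\<integral>l. exp (\<i> * of_real (\<bar>t\<bar> * l) - of_real R * zcoth (of_real l)) *
      ampl n k1 k2 (of_real l) \<partial>lborel)"
    define D where "D = (hk_d x t)\<^sup>2 / 4"
    have D: "D = R * (hk_theta y * y + ycot y)"
      using hk_d_exponent[OF x, of t] by (simp add: D_def R_def y(3)) (simp add: y_def \<omega>_def)
    define a where "a = ampl n k1 k2 (\<i> * of_real y)"
    define err where "err = of_real (exp D) * I - a * of_real (2 * q / norm x)"
    have sq: "sqrt (pi / (acoef y * R)) = 2 * q / norm x"
      unfolding q_def by (simp add: real_sqrt_divide real_sqrt_mult sqrtR)
    have err: "norm err \<le> L / (R * sqrt R)"
      using asymp[rule_format, of y R] y R
      by (simp only: err_def I_def D a_def tR y(3) sq exp_of_real)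
    have q: "q > 0" using ac by (simp add: q_def)
    define u where "u = (-1) ^ k1 * \<i> ^ k2"
    have u: "norm u = 1" by (simp add: u_def norm_mult norm_power)
    \<comment> \<open>Division is by the Gaussian factor only, which is positive, and never by the
      amplitude.\<close>
    define E where "E = u * err * of_real (norm x / (2 * q))"
    \<comment> \<open>(4 pi)^n (2 pi) equals 2 \<open>P\<close>, and this 2 cancels the one in
      2q/|x|.\<close>
    define P where "P = 4 ^ n * pi ^ (n + 1)"
    have P: "P > 0" by (simp add: P_def)
    have I: "I = of_real (exp (- D)) * (a * of_real (2 * q / norm x) + err)"
      by (simp add: err_def exp_minus flip: of_real_mult)
    have "hk_p n k1 k2 x t = u / of_real (2 * P) * I"
      unfolding hk_p_eq[OF assms(1)] by (simp add: u_def P_def I_def R_def power_mult_distrib mult_ac)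
    also have "\<dots> = of_real (1 / norm x * exp (- D) * (q / P)) * (u * a + E)"
      using nx q P unfolding I E_def by (simp add: field_simps)
    also have "u * a = of_real ((-1) ^ (k1 + k2) * hk_frac n k1 k2 y)"
      unfolding u_def a_def by (rule ampl_imaginary)
    also have "q / P = hk_Psi n \<omega>"
      using hk_Psi_eq[of \<omega> n] om by (simp add: q_def P_def y_def \<omega>_def)
    finally have main: "hk_p n k1 k2 x t = of_real (1 / norm x * exp (- D) * hk_Psi n \<omega>) *
      (of_real ((-1) ^ (k1 + k2) * hk_frac n k1 k2 y) + E)" .
    have "norm E = norm err * (norm x / (2 * q))" 
      unfolding E_def norm_mult norm_of_real u using q nx by simp
    also have "\<dots> \<le> L / (R * sqrt R) * (norm x / (2 * q))"
      using err q nx by (intro mult_right_mono) auto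
    also have "\<dots> = 4 * L / (norm x)\<^sup>2 * (1 / q)"
      unfolding sqrtR unfolding R_def using nx q by (simp add: field_simps power2_eq_square)
    also have "1 / q = sqrt (acoef y / pi)" by (simp add: q_def real_sqrt_divide)
    also have "4 * L / (norm x)\<^sup>2 * sqrt (acoef y / pi) \<le> 4 * L / (norm x)\<^sup>2 * sqrt (L / pi)"
      using ac L by (intro mult_left_mono) (auto simp: divide_right_mono)
    finally have "norm E \<le> 4 * L * sqrt (L / pi) / (norm x)\<^sup>2" by simp
    then show "\<exists>E. norm E \<le> 4 * L * sqrt (L / pi) / (norm x)\<^sup>2 \<and>
        hk_p n k1 k2 x t =
          complex_of_real (1 / norm x * exp (- (hk_d x t)\<^sup>2 / 4) * hk_Psi n (hk_omega x t)) *
          (complex_of_real ((-1) ^ (k1 + k2) * hk_frac n k1 k2 (hk_y (hk_omega x t))) + E)"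
      using main by (auto simp: D_def y_def \<omega>_def)
  qed
qed

end
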